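(* Let $\Gamma$ be a finite simple graph on $V=\{1,\dots,n\}$ and $I$ its edge ideal in $R=k[x_1,\dots,x_n]$, where $k$ is a field. Then $$\mathrm{astab}(I)=\max\{s(\Gamma_{c(F)})\mid F\in\mathcal{A}(\Gamma)\}+1.$$
   Context: The edge ideal of $\Gamma$ is generated by the monomials $x_ix_j$ with $\{i,j\}$ an edge of $\Gamma$. $\mathrm{Ass}(I^t)$ is the set of associated primes of $R/I^t$, and $\mathrm{astab}(I)$ is the least integer $t_0\ge 1$ such that $\mathrm{Ass}(I^t)=\mathrm{Ass}(I^{t+1})$ for all $t\ge t_0$ (it exists by a theorem of Brodmann). A (vertex) cover of $\Gamma$ is a subset of $V$ meeting every edge. For a cover $F$, the core $c(F)$ is the set of vertices of $F$ not adjacent to any vertex of $V\setminus F$; $c(F)=\emptyset$ if and only if $F$ is a minimal cover. $\Gamma_U$ denotes the induced subgraph on $U$. A graph is strongly non-bipartite if each of its connected components contains an odd cycle. $\mathcal{A}(\Gamma)$ is the set consisting of the minimal covers of $\Gamma$ and of the non-minimal covers $F$ of $\Gamma$ such that $\Gamma_{c(F)}$ is strongly non-bipartite. A dominating set of a graph $G$ is a set $U$ of vertices of $G$ such that every vertex of $G$ lies in $U$ or is adjacent to a vertex of $U$. A generalized ear decomposition of a connected graph is a finite sequence of walks in the graph, each without repetition of vertices other than its endpoints (so each walk is a path of length at least 1, a cycle, or a closed walk $i,j,i$ of length 2 along an edge), such that the first walk is closed, the endpoints of each subsequent walk are the only vertices of that walk belonging to earlier walks, and the walks pass through all vertices of the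 graph. An odd-beginning generalized ear decomposition of a strongly non-bipartite graph is a family of generalized ear decompositions, one of each connected component, each of whose first walk is an odd cycle. For a strongly non-bipartite graph $G$ with $m$ vertices and $c$ connected components, $\varphi^*(G)$ is the minimal total number of walks of even length in an odd-beginning generalized ear decomposition of $G$, and $\mu^*(G):=(\varphi^*(G)+m-c)/2$. If $F$ is a minimal cover, put $s(\Gamma_{c(F)}):=0$. If $F\in\mathcal{A}(\Gamma)$ is not a minimal cover, $s(\Gamma_{c(F)})$ is the minimum of $\mu^*(\Gamma_U)$ over all dominating sets $U$ of $\Gamma_{c(F)}$ such that $\Gamma_U$ is strongly non-bipartite. *)

theory Defs
  imports
    "HOL-Library.Poly_Mapping"
    "HOL-Algebra.QuotRing"
    "HOL-Algebra.Ideal_Product"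
    "HOL-Algebra.Module"
    "HOL-Algebra.Algebraic_Closure_Type"
    "Graph_Theory.Graph_Theory"
begin

section \<open>Edge ideals and stability of associated primes\<close>

text \<open>
  A monomial is a finitely supported exponent vector, and a polynomial is a finitely supported
  map from monomials to coefficients, multiplied by convolution.
\<close>

definition mpoly_ring :: "'v set \<Rightarrow> (('v \<Rightarrow>\<^sub>0 nat) \<Rightarrow>\<^sub>0 'k::comm_ring_1) ring" where
  "mpoly_ring V = ring_of_type_algebra \<lparr>carrier := {p. \<forall>m \<in> Poly_Mapping.keys p. Poly_Mapping.keys m \<subseteq> V}\<rparr>"

definition mpoly_var :: "'v \<Rightarrow> ('v \<Rightarrow>\<^sub>0 nat) \<Rightarrow>\<^sub>0 'k::comm_ring_1" where
  "mpoly_var i = Poly_Mapping.single (Poly_Mapping.single i 1) 1"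

definition edge_ideal :: "('v, 'e) pre_digraph \<Rightarrow> (('v \<Rightarrow>\<^sub>0 nat) \<Rightarrow>\<^sub>0 'k::comm_ring_1) set" where
  "edge_ideal G = Idl\<^bsub>mpoly_ring (verts G)\<^esub> {mpoly_var i * mpoly_var j | i j. dominates G i j}"

text \<open>The quotient ring \<open>R/J\<close> regarded as an \<open>R\<close>-module.\<close>

definition quot_module :: "'a ring \<Rightarrow> 'a set \<Rightarrow> ('a, 'a set) module" where
  "quot_module R J =
     ring.extend (R Quot J)
       (module.fields (\<lambda>r A. (J +>\<^bsub>R\<^esub> r) \<otimes>\<^bsub>R Quot J\<^esub> A))"

definition associated_primes :: "'a ring \<Rightarrow> ('a, 'm) module \<Rightarrow> 'a set set" where
  "associated_primes R M =
     {P. primeideal P R \<and> (\<exists>x \<in> carrier M. P = {r \<in> carrier R. r \<odot>\<^bsub>M\<^esub> x = \<zero>\<^bsub>M\<^esub>})}"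

text \<open>
  Powers of an ideal are taken in the monoid \<^term>\<open>ideals_set R\<close> of ideals under ideal product.
\<close>

definition Ass_power :: "'a ring \<Rightarrow> 'a set \<Rightarrow> nat \<Rightarrow> 'a set set" where
  "Ass_power R I t = associated_primes R (quot_module R (I [^]\<^bsub>ideals_set R\<^esub> t))"

definition astab :: "'a ring \<Rightarrow> 'a set \<Rightarrow> nat" where
  "astab R I = (LEAST t0. 1 \<le> t0 \<and> (\<forall>t \<ge> t0. Ass_power R I t = Ass_power R I (t + 1)))"


section \<open>Covers, cores and dominating sets\<close>

text \<open>
  As in the library, a finite simple graph is a finite symmetric digraph without loops and
  parallel arcs (locale \<^locale>\<open>graph\<close>): the edge between \<open>u\<close> and \<open>v\<close> is the pair of opposite arcs,
  and \<^term>\<open>dominates G u v\<close> is adjacency.  Since adjacency is symmetric, the connected components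
  are the strongly connected components \<^const>\<open>pre_digraph.sccs\<close> (a set of induced subgraphs).
\<close>

definition vertex_cover :: "('v, 'e) pre_digraph \<Rightarrow> 'v set \<Rightarrow> bool" where
  "vertex_cover G F \<longleftrightarrow> F \<subseteq> verts G \<and> (\<forall>u v. dominates G u v \<longrightarrow> u \<in> F \<or> v \<in> F)"

definition minimal_cover :: "('v, 'e) pre_digraph \<Rightarrow> 'v set \<Rightarrow> bool" where
  "minimal_cover G F \<longleftrightarrow> vertex_cover G F \<and> \<not> (\<exists>F'. F' \<subset> F \<and> vertex_cover G F')"

definition cover_core :: "('v, 'e) pre_digraph \<Rightarrow> 'v set \<Rightarrow> 'v set" where
  "cover_core G F = {v \<in> F. \<forall>u \<in> verts G - F. \<not> dominates G v u}"

definition dominating_set :: "('v, 'e) pre_digraph \<Rightarrow> 'v set \<Rightarrow> bool" where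
  "dominating_set G U \<longleftrightarrow>
     U \<subseteq> verts G \<and> (\<forall>v \<in> verts G. v \<in> U \<or> (\<exists>u \<in> U. dominates G v u))"


section \<open>Generalized ear decompositions\<close>

text \<open>
  Walks are nonempty vertex lists, closed walks repeating their initial vertex at the end.
  The two distinctness conditions say that the only possible coincidence between entries is
  that of the first with the last one.
\<close>

definition ear_walk :: "('v, 'e) pre_digraph \<Rightarrow> 'v list \<Rightarrow> bool" where
  "ear_walk G w \<longleftrightarrow>
     vwalk w G \<and> vwalk_length w \<ge> 1 \<and> distinct (butlast w) \<and> distinct (tl w)"

text \<open>
  In a loopfree graph a closed walk has length at least 2, so an odd closed one without further
  repetitions has length at least 3 and is a cycle; the walks \<open>[i, j, i]\<close> have even length.
\<close>

definition odd_cycle :: "('v, 'e) pre_digraph \<Rightarrow> 'v list \<Rightarrow> bool" where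
  "odd_cycle G w \<longleftrightarrow> ear_walk G w \<and> hd w = last w \<and> odd (vwalk_length w)"

definition strongly_nonbipartite :: "('v, 'e) pre_digraph \<Rightarrow> bool" where
  "strongly_nonbipartite G \<longleftrightarrow> (\<forall>C \<in> pre_digraph.sccs G. \<exists>w. odd_cycle C w)"

definition gen_ear_decomp :: "('v, 'e) pre_digraph \<Rightarrow> 'v list list \<Rightarrow> bool" where
  "gen_ear_decomp G ws \<longleftrightarrow>
     ws \<noteq> [] \<and>
     (\<forall>w \<in> set ws. ear_walk G w) \<and>
     hd (ws ! 0) = last (ws ! 0) \<and>
     (\<forall>k. 0 < k \<and> k < length ws \<longrightarrow>
        set (ws ! k) \<inter> (\<Union>j<k. set (ws ! j)) = {hd (ws ! k), last (ws ! k)}) \<and>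
     (\<Union>w \<in> set ws. set w) = verts G"

definition odd_beginning_ear_decomp ::
    "('v, 'e) pre_digraph \<Rightarrow> (('v, 'e) pre_digraph \<Rightarrow> 'v list list) \<Rightarrow> bool" where
  "odd_beginning_ear_decomp G D \<longleftrightarrow>
     (\<forall>C \<in> pre_digraph.sccs G. gen_ear_decomp C (D C) \<and> odd_cycle C (D C ! 0))"

definition even_walks ::
    "('v, 'e) pre_digraph \<Rightarrow> (('v, 'e) pre_digraph \<Rightarrow> 'v list list) \<Rightarrow> nat" where
  "even_walks G D =
     (\<Sum>C \<in> pre_digraph.sccs G. length (filter (\<lambda>w. even (vwalk_length w)) (D C)))"

definition phi_star :: "('v, 'e) pre_digraph \<Rightarrow> nat" where
  "phi_star G = (LEAST k. \<exists>D. odd_beginning_ear_decomp G D \<and> even_walks G D = k)"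

definition mu_star :: "('v, 'e) pre_digraph \<Rightarrow> real" where
  "mu_star G =
     (real (phi_star G) + real (card (verts G)) - real (card (pre_digraph.sccs G))) / 2"


section \<open>The covers and the invariant entering the formula\<close>

definition admissible_covers :: "('v, 'e) pre_digraph \<Rightarrow> 'v set set" where
  "admissible_covers G =
     {F. minimal_cover G F} \<union>
     {F. vertex_cover G F \<and> \<not> minimal_cover G F \<and>
         strongly_nonbipartite (G \<restriction> cover_core G F)}"

text \<open>The invariant written \<open>s(\<Gamma>\<^bsub>c(F)\<^esub>)\<close>.\<close>

definition s_core :: "('v, 'e) pre_digraph \<Rightarrow> 'v set \<Rightarrow> real" where
  "s_core G F =
     (if minimal_cover G F then 0
      else Min {mu_star (G \<restriction> U) | U.
                  dominating_set (G \<restriction> cover_core G F) U \<and> strongly_nonbipartite (G \<restriction> U)})"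

end

theory Submission
  imports Defs "HOL-Library.Multiset" "HOL-Library.Disjoint_Sets"
begin

text \<open>
  Powers of \<open>I\<close> are monomial ideals, so \<open>P\<^sub>F \<in> Ass(I\<^sup>t)\<close> iff \<open>I\<^sup>t : x\<^sup>a = P\<^sub>F\<close> for some exponent vector \<open>a\<close>.
  Here \<open>x\<^sup>a \<in> I\<^sup>t\<close> says that the multiset \<open>a\<close> of vertices contains \<open>t\<close> edges; let \<open>\<nu>(a)\<close> be the largest
  such \<open>t\<close>.  The vertices outside the core contribute a constant, which leaves vectors \<open>a\<close> on the core
  with \<open>\<nu>(a) < t \<le> \<nu>(a + i)\<close> for all \<open>i\<close> in the core.  Removing elements whose removal lowers \<open>\<nu>\<close>, we
  reach \<open>\<nu>(a - i) = \<nu>(a)\<close> for all \<open>i\<close> in the support \<open>U\<close>, which dominates the core.  Growing a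
  factor-critical submultiset by odd ears, as in Lovasz's ear decomposition theorem, yields odd closed
  walks and odd walks in each component of \<open>U\<close>; cutting these at repeated vertices gives a generalized
  ear decomposition whose walk lengths \<open>l\<close> satisfy \<open>\<Sum> \<lfloor>l/2\<rfloor> \<le> \<nu>(a)\<close>, and this sum is
  \<open>(\<phi> + m - c)/2\<close>.  Conversely, an ear decomposition yields a factor-critical vector once an endpoint
  of each even ear is doubled.
\<close>

section \<open>Matchings and factor-critical multisets\<close>

text \<open>What is proved is finer than the formula: for t >= 1 the primes in Ass(I^t) are exactly
  the P_F with F in \<open>admissible_covers\<close> and s <= t - 1. So Ass(I^t) increases with t, a
  cover with invariant s enters at t = s + 1, and the stability index is the point where the last
  cover enters. Multiplicities shape the combinatorics. A multiset a stands for the graph in which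
  each vertex v is replaced by \<open>count a v\<close> nonadjacent copies, and an edge may be used
  several times. The ears grown there project to walks with repetitions. Cutting them costs nothing
  because floor(l1/2) + floor(l2/2) \<le> floor((l1 + l2)/2). On the algebraic side neither an
  associated prime P nor the element r with P = J : r is monomial beforehand. Leading monomials
  settle this, which is why the variables carry a linear order.\<close>

locale adjacency =
  fixes adj :: "'v \<Rightarrow> 'v \<Rightarrow> bool"
  assumes adj_sym: "adj u v \<Longrightarrow> adj v u" and adj_irrefl: "\<not> adj v v"
begin

text \<open>No disjointness is asked and an edge may occur several times: the inclusion of
  \<open>\<Sum>\<^sub># M\<close> in a multiset, counted with multiplicities, takes that role, as
  for a product of edge monomials dividing a monomial.\<close>

definition matching :: "'v multiset multiset \<Rightarrow> bool" where
  "matching M \<longleftrightarrow> (\<forall>e \<in># M. \<exists>u v. e = {#u, v#}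
    \<and> adj u v)"

definition packs :: "nat \<Rightarrow> 'v multiset \<Rightarrow> bool" where
  "packs t a \<longleftrightarrow> (\<exists>M. matching M \<and> size M = t
    \<and> \<Sum>\<^sub># M \<subseteq># a)"

definition perfect :: "'v multiset \<Rightarrow> bool" where
  "perfect a \<longleftrightarrow> (\<exists>M. matching M \<and> \<Sum>\<^sub># M = a)"

text \<open>Factor-criticality in the sense of Gallai and Lovasz, for the graph with
  \<open>count b v\<close> nonadjacent copies of each vertex v.\<close>

definition factor_critical :: "'v multiset \<Rightarrow> bool" where
  "factor_critical b \<longleftrightarrow> b \<noteq> {#}
    \<and> (\<forall>u \<in># b. perfect (b - {#u#}))"

lemma successively_middle: "successively P (p @ q @ r) \<Longrightarrow> successively P q"
  by (simp add: successively_append_iff)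

lemma list_ends: "2 \<le> length w \<Longrightarrow> \<exists>x m s. w = x # m @ [s]"
  by (cases w; cases "tl w" rule: rev_cases) auto

lemma successively_join:
  "successively P (p @ [v]) \<Longrightarrow> successively P (v # q)
    \<Longrightarrow> successively P (p @ v # q)"
  by (auto simp: successively_append_iff successively_Cons)

lemma matching_simps [simp]:
  "matching {#}"
  "matching (add_mset e M) \<longleftrightarrow> (\<exists>u v. e = {#u, v#} \<and> adj u v)
    \<and> matching M"
  "matching (M + N) \<longleftrightarrow> matching M \<and> matching N"
  by (auto simp: matching_def)

lemma matching_subset: "matching M \<Longrightarrow> N \<subseteq># M \<Longrightarrow> matching N"
  by (auto simp: matching_def dest: mset_subset_eqD)

lemma size_Union_matching: "matching M \<Longrightarrow> size (\<Sum>\<^sub># M) = 2 * size M"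
  by (induction M) auto

lemma matching_edge_at:
  assumes "matching M" "v \<in># \<Sum>\<^sub># M"
  obtains u where "{#v, u#} \<in># M" "adj v u"
proof -
  obtain e where e: "e \<in># M" "v \<in># e"
    using assms(2) by auto
  then obtain p q where "e = {#p, q#}" "adj p q"
    using assms(1) by (auto simp: matching_def)
  with e that show thesis
    by (auto simp: add_mset_commute dest: adj_sym)
qed

lemma matching_singleton: "adj u v \<Longrightarrow> matching {#{#u, v#}#}"
  unfolding matching_def by auto

lemma packs_zero [simp]: "packs 0 a"
  by (auto simp: packs_def intro!: exI[of _ "{#}"])

lemma packs_mono: "packs t a \<Longrightarrow> a \<subseteq># b \<Longrightarrow> packs t b"
  by (auto simp: packs_def intro: subset_mset.order_trans)

lemma packs_Suc: "packs (Suc t) a \<Longrightarrow> packs t a"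
  unfolding packs_def
proof (elim exE conjE)
  fix M assume M: "matching M" "size M = Suc t" "\<Sum>\<^sub># M \<subseteq># a"
  obtain e M' where M': "M = add_mset e M'"
    using M(2) by (cases M) auto
  then have "\<Sum>\<^sub># M' \<subseteq># \<Sum>\<^sub># M"
    by simp
  then have "\<Sum>\<^sub># M' \<subseteq># a"
    using M(3) subset_mset.order_trans by blast
  with M M' show "\<exists>M. matching M \<and> size M = t \<and> \<Sum>\<^sub># M \<subseteq># a"
    by auto
qed

lemma packs_antimono: "packs t a \<Longrightarrow> s \<le> t \<Longrightarrow> packs s a"
  using inc_induct[of s t "\<lambda>s. packs s a"] packs_Suc by blast

lemma packs_add: "packs s a \<Longrightarrow> packs t b \<Longrightarrow> packs (s + t) (a + b)"
  unfolding packs_def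
  by (metis matching_simps(3) size_union subset_mset.add_mono sum_mset.union)

lemma packs_edge: "adj u v \<Longrightarrow> packs 1 {#u, v#}"
  unfolding packs_def by (rule exI[of _ "{#{#u, v#}#}"])
    (simp add: matching_singleton del: matching_simps)

lemma perfect_packs: "perfect a \<Longrightarrow> size a = 2 * k \<Longrightarrow> packs k a"
  unfolding perfect_def packs_def
  by (metis mult_left_cancel size_Union_matching subset_mset.order_refl zero_neq_numeral)

lemma perfect_empty [simp]: "perfect {#}"
  by (auto simp: perfect_def intro!: exI[of _ "{#}"])

lemma perfect_add: "perfect a \<Longrightarrow> perfect b \<Longrightarrow> perfect (a + b)"
  unfolding perfect_def by (metis matching_simps(3) sum_mset.union)

lemma perfect_edge: "adj u v \<Longrightarrow> perfect {#u, v#}"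
  unfolding perfect_def by (rule exI[of _ "{#{#u, v#}#}"])
    (simp add: matching_singleton del: matching_simps)

lemma perfect_sum: "(\<And>i. i \<in> I \<Longrightarrow> perfect (f i))
  \<Longrightarrow> perfect (\<Sum>i\<in>I. f i)"
  by (induction I rule: infinite_finite_induct) (auto intro: perfect_add)

text \<open>At most one edge of a packing uses a given copy of i, so dropping that edge
  suffices.\<close>

lemma packs_remove1:
  assumes "packs t a" shows "packs (t - 1) (a - {#i#})"
proof -
  obtain M where M: "matching M" "size M = t" "\<Sum>\<^sub># M \<subseteq># a"
    using assms by (auto simp: packs_def)
  show ?thesis
  proof (cases "i \<in># \<Sum>\<^sub># M")
    case True
    then obtain u where u: "{#i, u#} \<in># M"
      using M(1) matching_edge_at by blast
    then obtain M' where M': "M = add_mset {#i, u#} M'"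
      by (blast dest: multi_member_split)
    then have "add_mset i (\<Sum>\<^sub># M') \<subseteq># a"
      using M(3) by (auto intro: subset_mset.order_trans[rotated])
    then have "\<Sum>\<^sub># M' \<subseteq># a - {#i#}"
      by (simp add: insert_subset_eq_iff)
    then show ?thesis
      using M M' by (auto simp: packs_def)
  next
    case False
    then have 0: "count (\<Sum>\<^sub># M) i = 0"
      by (simp only: count_eq_zero_iff not_False_eq_True)
    have "\<Sum>\<^sub># M \<subseteq># a - {#i#}"
    proof (rule mset_subset_eqI)
      fix u show "count (\<Sum>\<^sub># M) u \<le> count (a - {#i#}) u"
        using 0 mset_subset_eq_count[OF M(3), of u] by (cases "u = i") auto
    qed
    then have "packs t (a - {#i#})"
      using M by (auto simp: packs_def)
    then show ?thesis
      using packs_antimono by (metis diff_le_self)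
  qed
qed

section \<open>Factor-critical multisets and odd ears\<close>

lemma perfect_path: "successively adj w \<Longrightarrow> even (length w)
  \<Longrightarrow> perfect (mset w)"
proof (induction w rule: induct_list012)
  case (3 x y zs)
  then have "perfect ({#x, y#} + mset zs)"
    by (intro perfect_add perfect_edge) (auto simp: successively_Cons)
  then show ?case by simp
qed auto

text \<open>If u occurs in b, a copy is taken from b and w is matched along itself. Otherwise
  deleting u leaves two pieces of w of opposite parity; the odd piece is completed by the endpoint x
  or s on its side, and b minus this endpoint is matched. The walk may be closed, repeat vertices
  and re-enter b, because only multiplicities are recorded.\<close>

lemma factor_critical_ear:
  assumes b: "factor_critical b" and x: "x \<in># b" and s: "s \<in># b"
    and w: "successively adj (x # w @ [s])" "even (length w)"
  shows "factor_critical (b + mset w)"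
  unfolding factor_critical_def
proof (intro conjI ballI)
  show "b + mset w \<noteq> {#}"
    using b by (auto simp: factor_critical_def)
  fix u assume u: "u \<in># b + mset w"
  show "perfect (b + mset w - {#u#})"
  proof (cases "u \<in># b")
    case True
    have "perfect ((b - {#u#}) + mset w)"
      using b True w
      by (intro perfect_add perfect_path)
        (auto simp: factor_critical_def successively_Cons successively_append_iff)
    then show ?thesis
      using True by (simp add: add.commute multiset_diff_union_assoc)
  next
    case False
    then have "u \<in> set w" using u by auto
    then obtain p q where pq: "w = p @ u # q"
      by (meson split_list)
    have succ: "successively adj (x # p)" "successively adj p" "successively adj q"
      "successively adj (q @ [s])"
      using w(1) successively_middle[of adj "[]" "x # p" "u # q @ [s]"]
        successively_middle[of adj "[x]" p "u # q @ [s]"]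
        successively_middle[of adj "x # p @ [u]" q "[s]"]
          successively_middle[of adj "x # p @ [u]" "q @ [s]" "[]"]
      by (auto simp: pq)
    show ?thesis
    proof (cases "even (length p)")
      case True
      have "perfect (mset p + mset (q @ [s]) + (b - {#s#}))"
        using b s True w(2) succ by (intro perfect_add perfect_path)
          (auto simp: factor_critical_def pq)
      moreover have "mset p + mset (q @ [s]) + (b - {#s#}) = b + mset w - {#u#}"
        using s by (auto simp: pq dest: multi_member_split)
      ultimately show ?thesis by simp
    next
      case False
      have "perfect (mset (x # p) + mset q + (b - {#x#}))"
        using b x False w(2) succ by (intro perfect_add perfect_path)
          (auto simp: factor_critical_def pq)
      moreover have "mset (x # p) + mset q + (b - {#x#}) = b + mset w - {#u#}"
        using x by (auto simp: pq dest: multi_member_split)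
      ultimately show ?thesis by simp
    qed
  qed
qed

lemma factor_critical_singleton [simp]: "factor_critical {#r#}"
  by (auto simp: factor_critical_def)

text \<open>u' is the partner of u in a perfect matching of b minus v; deleting a vertex other than
  u keeps u among the matched ones.\<close>

lemma factor_critical_neighbour:
  assumes "factor_critical b" "u \<in># b" "v \<in># b" "u \<noteq> v"
  obtains u' where "u' \<in># b" "adj u u'"
proof -
  have "perfect (b - {#v#})"
    using assms by (auto simp: factor_critical_def)
  then obtain M where M: "matching M" "\<Sum>\<^sub># M = b - {#v#}"
    by (auto simp: perfect_def)
  moreover have "u \<in># b - {#v#}"
    using assms by (simp add: in_diff_count)
  ultimately obtain u' where u': "{#u, u'#} \<in># M" "adj u u'"
    using matching_edge_at[of M u] by auto
  then have "u' \<in># \<Sum>\<^sub># M" by (auto intro!: bexI[of _ "{#u, u'#}"])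
  then have "u' \<in># b" using M(2) by (metis in_diffD)
  with u'(2) that show thesis by blast
qed

text \<open>Serves to fill slack later: an ear running to and fro along an edge inside b raises the
  size by two and keeps the support.\<close>

lemma factor_critical_enlarge:
  assumes "factor_critical b" "u \<in># b" "v \<in># b" "u \<noteq> v"
  shows "\<exists>b'. factor_critical b' \<and> set_mset b' = set_mset b \<and> size b'
    = size b + 2 * m"
proof (induction m)
  case 0 then show ?case using assms(1) by auto
next
  case (Suc m)
  then obtain b' where b': "factor_critical b'" "set_mset b' = set_mset b"
    "size b' = size b + 2 * m"
    by auto
  obtain u' where u': "u' \<in># b'" "adj u u'"
    using factor_critical_neighbour[of b' u v] b' assms by auto
  \<comment> \<open>The walk is u, u', u, u', with interior [u', u].\<close>
  have "factor_critical (b' + mset [u', u])"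
    by (rule factor_critical_ear[OF b'(1), of u u']) (use b' assms u' adj_sym in auto)
  then show ?case
    using b' u' assms by (intro exI[of _ "b' + mset [u', u]"]) auto
qed

section \<open>Ear decompositions, and cutting walks into ears\<close>

definition ear :: "'v list \<Rightarrow> bool" where
  "ear w \<longleftrightarrow> successively adj w \<and> 2 \<le> length w
    \<and> distinct (butlast w) \<and> distinct (tl w)"

text \<open>S collects the vertices reached and k sums floor(l/2) over the lengths l of the walks; a
  list w is a walk of length \<open>length w - 1\<close>. The odd closed first walk is built
  in.\<close>

inductive ear_decomp :: "'v set \<Rightarrow> nat \<Rightarrow> 'v list list \<Rightarrow> bool"
  where
  start: "ear w \<Longrightarrow> hd w = last w
    \<Longrightarrow> odd (length w - 1) \<Longrightarrow>
    ear_decomp (set w) ((length w - 1) div 2) [w]"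
| step: "ear_decomp S k ws \<Longrightarrow> ear w \<Longrightarrow> set w \<inter> S
  = {hd w, last w} \<Longrightarrow>
    ear_decomp (S \<union> set w) (k + (length w - 1) div 2) (ws @ [w])"

text \<open>A walk that returns to S or repeats an interior vertex is cut there into two shorter
  walks whose lengths add up, and the sum of floor(l/2) does not grow. What cannot be cut is an ear
  or adds no vertex.\<close>

lemma ear_decomp_absorb:
  assumes "ear_decomp S k ws" "successively adj w" "w \<noteq> []" "hd w \<in> S" "last w \<in> S"
  shows "\<exists>k' ws'. ear_decomp (S \<union> set w) k' ws'
    \<and> k' \<le> k + (length w - 1) div 2"
  using assms
proof (induction "length w" arbitrary: w S k ws rule: less_induct)
  case less
  show ?case
  proof (cases "length w \<ge> 2")
    case False
    then obtain x where "w = [x]" using \<open>w \<noteq> []\<close>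
      by (cases w; cases "tl w") auto
    then show ?thesis using less.prems by (auto simp: insert_absorb)
  next
    case True
    then obtain x m s where w: "w = x # m @ [s]" using list_ends by blast
    have xs: "x \<in> S" "s \<in> S" using less.prems w by auto
    show ?thesis
    proof (cases "set m \<inter> S = {}")
      case False
      then obtain v where v: "v \<in> set m" "v \<in> S" by auto
      then obtain p q where pq: "m = p @ v # q" by (meson split_list)
      have "successively adj (x # p @ [v])" "successively adj (v # q @ [s])"
        using less.prems(2) successively_middle[of adj "[]" "x # p @ [v]" "q @ [s]"]
          successively_middle[of adj "x # p" "v # q @ [s]" "[]"] by (auto simp: w pq)
      note s = this
      obtain k1 ws1 where 1: "ear_decomp (S \<union> set (x # p @ [v])) k1 ws1"
        "k1 \<le> k + (length p + 1) div 2"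
        using less.hyps[of "x # p @ [v]" S k ws] less.prems(1) s v xs by (auto simp: w pq)
      obtain k2 ws2 where 2: "ear_decomp (S \<union> set (x # p @ [v]) \<union> set (v # q @ [s]))
        k2 ws2"
        "k2 \<le> k1 + (length q + 1) div 2"
        using less.hyps[of "v # q @ [s]" "S \<union> set (x # p @ [v])" k1 ws1] 1(1) s v xs
          by (auto simp: w pq)
      have "S \<union> set (x # p @ [v]) \<union> set (v # q @ [s]) = S \<union> set w"
        by (auto simp: w pq)
      moreover have "k2 \<le> k + (length w - 1) div 2"
        using 1(2) 2(2) by (auto simp: w pq)
      ultimately show ?thesis using 2(1) by auto
    next
      case disj: True
      show ?thesis
      proof (cases "distinct m")
        case True
        show ?thesis
        proof (cases "m = []")
          case m: True
          \<comment> \<open>An edge between two vertices already reached is dropped.\<close>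
          then have "S \<union> set w = S" using xs w by auto
          then show ?thesis using less.prems(1) by (metis le_add1)
        next
          case False
          have "ear w"
            unfolding ear_def using less.prems(2) True disj xs by (auto simp: w butlast_append)
          moreover have "set w \<inter> S = {hd w, last w}"
            using disj xs by (auto simp: w)
          ultimately show ?thesis
            using step[OF less.prems(1)] by blast
        qed
      next
        case False
        then obtain p v q r where pq: "m = p @ [v] @ q @ [v] @ r"
          using not_distinct_decomp by blast
        have s: "successively adj (x # p @ v # r @ [s])" "successively adj (v # q @ [v])"
          using less.prems(2) successively_middle[of adj "[]" "x # p @ [v]" "q @ [v] @ r @ [s]"]
            successively_middle[of adj "x # p @ [v] @ q" "v # r @ [s]" "[]"]
            successively_middle[of adj "x # p" "v # q @ [v]" "r @ [s]"]
            successively_join[of adj "x # p" v "r @ [s]"] by (auto simp: w pq)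
        \<comment> \<open>The walk without its closed segment is absorbed first; then v is reached
          and the segment from v to v can follow.\<close>
        obtain k1 ws1 where 1: "ear_decomp (S \<union> set (x # p @ v # r @ [s])) k1 ws1"
          "k1 \<le> k + (length p + length r + 2) div 2"
          using less.hyps[of "x # p @ v # r @ [s]" S k ws] less.prems(1) s xs by (auto simp: w pq)
        obtain k2 ws2 where 2: "ear_decomp (S \<union> set (x # p @ v # r @ [s]) \<union> set (v # q
          @ [v])) k2 ws2"
          "k2 \<le> k1 + (length q + 1) div 2"
          using less.hyps[of "v # q @ [v]" "S \<union> set (x # p @ v # r @ [s])" k1 ws1] 1(1) s xs
          by (auto simp: w pq)
        have "S \<union> set (x # p @ v # r @ [s]) \<union> set (v # q @ [v]) = S \<union> set w"
          by (auto simp: w pq)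
        moreover have "k2 \<le> k + (length w - 1) div 2"
          using 1(2) 2(2) by (auto simp: w pq)
        ultimately show ?thesis using 2(1) by auto
      qed
    qed
  qed
qed

text \<open>A repeated vertex splits the walk into two closed walks of odd total length; the odd one
  gives a decomposition by induction, and the other is absorbed. The list of an odd closed walk has
  an even number of entries, since its start is written twice.\<close>

lemma ear_decomp_odd_closed_walk:
  assumes "successively adj w" "hd w = last w" "even (length w)" "w \<noteq> []"
  shows "\<exists>k ws. ear_decomp (set w) k ws \<and> k \<le> (length w - 1) div 2"
  using assms
proof (induction "length w" arbitrary: w rule: less_induct)
  case less
  have len: "2 \<le> length w" using less.prems(3,4) by (auto intro: dvd_imp_le)
  then obtain x m where w: "w = x # m @ [x]"
    using list_ends[OF len] less.prems(2) by auto
  show ?case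
  proof (cases "distinct (x # m)")
    case True
    then have "ear w" using less.prems len by (auto simp: ear_def w butlast_append)
    moreover have "odd (length w - 1)" using less.prems(3) len by auto
    ultimately show ?thesis using start[of w] less.prems by blast
  next
    case False
    then obtain p v q r where pq: "x # m = p @ [v] @ q @ [v] @ r"
      using not_distinct_decomp by blast
    have w2: "w = p @ v # q @ v # r @ [x]" using pq w by (metis append_Cons append_Nil append_assoc)
    have hp: "p = [] \<and> v = x \<or> p \<noteq> [] \<and> hd p = x" using pq by (cases p) auto
    \<comment> \<open>B is the rest of the closed walk, based at v: from the second occurrence of v
      to the end x, then from the start x through p to v.\<close>
    define A B where "A = v # q @ [v]" and "B = v # r @ p @ [v]"
    have sA: "successively adj A"
      using less.prems(1) successively_middle[of adj p "v # q @ [v]" "r @ [x]"]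
        by (auto simp: A_def w2)
    have s1: "successively adj (p @ [v])" "successively adj (v # r @ [x])"
      using less.prems(1) successively_middle[of adj "[]" "p @ [v]" "q @ [v] @ r @ [x]"]
        successively_middle[of adj "p @ [v] @ q" "v # r @ [x]" "[]"] by (auto simp: w2)
    have sB: "successively adj B"
    proof (cases p)
      case Nil
      then show ?thesis using s1 hp by (simp add: B_def)
    next
      case (Cons x' p')
      then show ?thesis using s1 hp successively_join[of adj "v # r" x "p' @ [v]"]
        by (simp add: B_def)
    qed
    have sets: "set A \<union> set B = set w" using hp by (cases p) (auto simp: A_def B_def w2)
    have lens: "length A + length B = length w + 1" "length A \<ge> 2" "length B \<ge> 2"
      by (auto simp: A_def B_def w2)
    have ends: "hd A = v" "last A = v" "hd B = v" "last B = v" "v \<in> set A" "v \<in> set B"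
      "A \<noteq> []" "B \<noteq> []"
      by (auto simp: A_def B_def)
    \<comment> \<open>W is whichever of A and B has odd length as a walk, W' the other one.\<close>
    have main: ?thesis if X: "W \<in> {A, B}" "W' \<in> {A,B}" "set W \<union> set W' = set w"
      "even (length W)" "length W + length W' = length w + 1" for W W'
    proof -
      have Z: "successively adj Q \<and> hd Q = v \<and> last Q = v \<and> v \<in> set Q
        \<and> Q \<noteq> [] \<and> 2 \<le> length Q"
        if "Q = A \<or> Q = B" for Q
        using that sA sB ends lens(2,3) by blast
      have X': "W = A \<or> W = B" "W' = A \<or> W' = B" using X(1,2) by auto
      have XX: "length W < length w" "successively adj W" "hd W = last W" "W \<noteq> []"
        "hd W' \<in> set W" "last W' \<in> set W"
        "successively adj W'" "W' \<noteq> []" "length W \<ge> 2" "length W' \<ge> 2"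
        using Z[OF X'(1)] Z[OF X'(2)] X(5) by auto
      obtain k ws where 1: "ear_decomp (set W) k ws" "k \<le> (length W - 1) div 2"
        using less.hyps[of W] XX X(4) by auto
      obtain k' ws' where 2: "ear_decomp (set W \<union> set W') k' ws'"
        "k' \<le> k + (length W' - 1) div 2"
        using ear_decomp_absorb[OF 1(1) XX(7,8,5,6)] by auto
      have "k' \<le> (length w - 1) div 2"
        using 1 2 X(4,5) XX(9,10) less.prems(3) by auto
      then show ?thesis using 2 X(3) by auto
    qed
    have "even (length A) \<or> even (length B)" using lens(1) less.prems(3)
      by presburger
    then show ?thesis using main[of A B] main[of B A] sets lens by (auto simp: Un_commute)
  qed
qed

text \<open>The size 2k + 1 is one seed vertex and two elements for each unit of floor(l/2). The two
  distinct vertices in the conclusion serve to find neighbours inside b.\<close>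

lemma ear_decomp_factor_critical:
  assumes "ear_decomp S k ws"
  shows "\<exists>b. factor_critical b \<and> set_mset b = S \<and> size b = 2 * k + 1
    \<and> (\<exists>u v. u \<in> S \<and> v \<in> S \<and> u \<noteq> v)"
  using assms
proof induction
  case (start w)
  then obtain x m where w: "w = x # m @ [x]"
    using list_ends[of w] by (auto simp: ear_def)
  have ev: "even (length m)" using start(3) by (auto simp: w)
  have fc: "factor_critical ({#x#} + mset m)"
    by (rule factor_critical_ear[of _ x x]) (use start ev in \<open>auto simp: ear_def w\<close>)
  have "m \<noteq> []" using start(1) adj_irrefl by (auto simp: ear_def w)
  moreover have "x \<notin> set m" using start(1) by (auto simp: ear_def w butlast_append)
  ultimately have "\<exists>u v. u \<in> set w \<and> v \<in> set w \<and> u \<noteq> v"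
    by (intro exI[of _ x] exI[of _ "hd m"]) (auto simp: w)
  with fc ev show ?case
    by (intro exI[of _ "{#x#} + mset m"]) (simp add: w)
next
  case (step S k ws w)
  then obtain b where b: "factor_critical b" "set_mset b = S" "size b = 2 * k + 1"
    and "\<exists>u v. u \<in> S \<and> v \<in> S \<and> u \<noteq> v"
    by auto
  then obtain u v where uv: "u \<in> S" "v \<in> S" "u \<noteq> v" by auto
  obtain x m s where w: "w = x # m @ [s]"
    using step(2) list_ends[of w] by (auto simp: ear_def)
  have xs: "x \<in># b" "s \<in># b" using step b by (auto simp: w)
  have succ: "successively adj w" using step by (auto simp: ear_def)
  show ?case
  proof (cases "even (length m)")
    case True
    have "factor_critical (b + mset m)"
      using factor_critical_ear[OF b(1) xs] True succ by (auto simp: w)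
    moreover have "set_mset (b + mset m) = S \<union> set w"
      "size (b + mset m) = 2 * (k + (length w - 1) div 2) + 1"
      using b xs True by (auto simp: w)
    ultimately show ?thesis using uv by blast
  next
    case False
    \<comment> \<open>An even ear has an odd interior m. Prolonged by s and ending at a neighbour s'
      of s in b it becomes odd, at the price of a further copy of s.\<close>
    obtain s' where s': "s' \<in># b" "adj s s'"
      using factor_critical_neighbour[of b s u] factor_critical_neighbour[of b s v] b uv xs by metis
    have "factor_critical (b + mset (m @ [s]))"
      by (rule factor_critical_ear[OF b(1) xs(1) s'(1)])
        (use False succ s' in \<open>auto simp: w successively_Cons successively_append_iff
          hd_append split: if_splits\<close>)
    moreover have "set_mset (b + mset (m @ [s])) = S \<union> set w"
      "size (b + mset (m @ [s])) = 2 * (k + (length w - 1) div 2) + 1"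
      using b xs False by (auto simp: w elim: oddE)
    ultimately show ?thesis using uv by blast
  qed
qed


section \<open>Critical multisets and the factor-critical pieces inside them\<close>

lemma packs_descent:
  assumes "\<not> packs t a" "\<And>i. i \<in> c \<Longrightarrow> packs t (add_mset i a)"
  shows "\<exists>a' t'. a' \<subseteq># a \<and> t' \<le> t \<and> \<not> packs t' a' \<and>
    (\<forall>i \<in> c. packs t' (add_mset i a')) \<and>
      (\<forall>i \<in># a'. packs (t' - 1) (a' - {#i#}))"
  using assms
proof (induction "size a" arbitrary: a t rule: less_induct)
  case less
  show ?case
  proof (cases "\<forall>i \<in># a. packs (t - 1) (a - {#i#})")
    case True
    then show ?thesis using less.prems by blast
  next
    case False
    then obtain i where i: "i \<in># a" "\<not> packs (t - 1) (a - {#i#})"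
      by auto
    \<comment> \<open>Deleting i lowers the packing number here, while a packing of
      \<open>add_mset j a\<close> loses at most one edge: criticality survives with t - 1 for t. So
      the descent ends only when no deletion lowers the packing number.\<close>
    have "packs (t - 1) (add_mset j (a - {#i#}))" if "j \<in> c" for j
      using packs_remove1[OF less.prems(2)[OF that], of i] i(1) by simp
    moreover have "size (a - {#i#}) < size a"
      using i(1) by (rule size_Diff1_less)
    ultimately obtain a' t' where "a' \<subseteq># a - {#i#}" "t' \<le> t - 1" "\<not> packs t' a'"
      "\<forall>i \<in> c. packs t' (add_mset i a')"
        "\<forall>i \<in># a'. packs (t' - 1) (a' - {#i#})"
      using less.hyps[of "a - {#i#}" "t - 1"] i(2) by blast
    then show ?thesis
      by (meson diff_subset_eq_self diff_le_self order_trans subset_mset.order_trans)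
  qed
qed

text \<open>A packing of size t in \<open>add_mset i a\<close> does not fit into a, so it uses i;
  the partner of i differs from i and hence lies in a. This yields domination, even for an i that is
  already in the support.\<close>

lemma packs_new_neighbour:
  assumes "\<not> packs t a" "packs t (add_mset i a)"
  obtains u where "u \<in># a" "adj i u"
proof -
  obtain M where M: "matching M" "size M = t" "\<Sum>\<^sub># M \<subseteq># add_mset i a"
    using assms(2) by (auto simp: packs_def)
  have "i \<in># \<Sum>\<^sub># M"
  proof (rule ccontr)
    assume "i \<notin># \<Sum>\<^sub># M"
    then have 0: "count (\<Sum>\<^sub># M) i = 0"
      by (simp only: count_eq_zero_iff not_False_eq_True)
    have "\<Sum>\<^sub># M \<subseteq># a"
    proof (rule mset_subset_eqI)
      fix u show "count (\<Sum>\<^sub># M) u \<le> count a u"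
        using 0 mset_subset_eq_count[OF M(3), of u] by (cases "u = i") auto
    qed
    then show False using M assms(1) by (auto simp: packs_def)
  qed
  then obtain u where u: "{#i, u#} \<in># M" "adj i u"
    using M(1) matching_edge_at by blast
  then have "u \<in># \<Sum>\<^sub># M" by (auto intro!: bexI[of _ "{#i, u#}"])
  then have "u \<in># add_mset i a" using M(3) mset_subset_eqD by metis
  moreover have "u \<noteq> i" using u(2) adj_irrefl by auto
  ultimately show thesis using that u(2) by auto
qed

text \<open>
  Follow alternately the edges of a maximum matching \<open>M\<close> of \<open>a - b\<close> and of a maximum matching
  \<open>N\<close> of \<open>a\<close> missing one copy of \<open>y\<close>, never using an edge twice.  If this walk got stuck,
  exchanging the two kinds of edges along it would yield too large a matching; so it returns to \<open>b\<close>.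
\<close>
lemma factor_critical_ear_exists:
  assumes a: "\<not> packs (Suc s) a" "packs s (a - {#y#})" and y: "y \<in># a" "y \<notin># b"
    and b: "factor_critical b" "b \<subseteq># a" "size b = 2 * j + 1" "packs k (a - b)" "j + k = s"
    and x: "x \<in># b" "adj x y"
  shows "\<exists>w z. z \<in># b \<and> successively adj (x # w @ [z]) \<and> even (length w)
    \<and> y \<in> set w \<and>
    mset w \<subseteq># a - b \<and> length w div 2 \<le> k \<and> packs (k - length w div 2)
      (a - b - mset w)"
proof (rule ccontr)
  assume none: "\<not> ?thesis"
  obtain M where M: "matching M" "size M = k" "\<Sum>\<^sub># M \<subseteq># a - b"
    using b(4) by (auto simp: packs_def)
  obtain N where N: "matching N" "size N = s" "\<Sum>\<^sub># N \<subseteq># a - {#y#}"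
    using a(2) by (auto simp: packs_def)
  have Ma: "count (\<Sum>\<^sub># M) u \<le> count a u - count b u" for u
    using mset_subset_eq_count[OF M(3), of u] by simp
  have Na: "count (\<Sum>\<^sub># N) u + (if u = y then 1 else 0) \<le> count a u" for u
  proof -
    obtain n where "count a y = Suc n"
      using y(1) by (metis count_eq_zero_iff not0_implies_Suc)
    then show ?thesis using mset_subset_eq_count[OF N(3), of u] by (cases "u = y") simp_all
  qed
  \<comment> \<open>Otherwise k edges of a - b that spare a copy of y could be joined by the edge xy
    and the j edges matching b minus x, which makes s + 1 edges in a.\<close>
  have no_M: "\<not> packs k (a - b - {#y#})"
  proof
    assume "packs k (a - b - {#y#})"
    moreover have "packs j (b - {#x#})"
      using b x by (intro perfect_packs) (auto simp: factor_critical_def size_Diff_singleton)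
    ultimately have "packs (1 + (j + k)) ({#x, y#} + ((b - {#x#}) + (a - b - {#y#})))"
      using packs_edge[OF x(2)] by (intro packs_add)
    moreover have "{#x, y#} + ((b - {#x#}) + (a - b - {#y#})) = a"
    proof -
      obtain b' where b': "b = add_mset x b'" using x(1) by (blast dest: multi_member_split)
      obtain a' where a': "a = b + a'" using b(2) by (auto simp: mset_subset_eq_exists_conv)
      then have "y \<in># a'" using y by simp
      then obtain a'' where "a' = add_mset y a''" by (blast dest: multi_member_split)
      then show ?thesis by (simp add: a' b')
    qed
    ultimately show False using a(1) b(5) by simp
  qed
  \<comment> \<open>P and Q are the edges of M and N used so far. The trails built below run from y
    to v: the M-edges cover every entry of w but v, the N-edges every entry but y.\<close>
  define trail where "trail P Q w v \<longleftrightarrow> P \<subseteq># M \<and> Q \<subseteq># N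
    \<and> \<Sum>\<^sub># P + {#v#} = mset w \<and>
    \<Sum>\<^sub># Q + {#y#} = mset w \<and> v \<notin># b \<and> successively adj (x # w) \<and>
      last (x # w) = v" for P Q w v
  have sizes: "size P = size Q" if "trail P Q w v" for P Q w v
  proof -
    have "size (\<Sum>\<^sub># P) + 1 = size (\<Sum>\<^sub># Q) + 1"
      using that unfolding trail_def by (metis size_union size_single)
    then show ?thesis
      using that M(1) N(1) size_Union_matching matching_subset unfolding trail_def
      by (metis add_right_cancel mult_left_cancel zero_neq_numeral)
  qed
  have extend: "\<exists>P' Q' w' v'. trail P' Q' w' v' \<and> size Q' = Suc (size Q)"
    if t: "trail P Q w v" for P Q w v
  proof -
    have PQ: "P \<subseteq># M" "Q \<subseteq># N" and Pw: "\<Sum>\<^sub># P + {#v#} = mset w"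
      and Qw: "\<Sum>\<^sub># Q + {#y#} = mset w"
      and v: "v \<notin># b" and w: "successively adj (x # w)" "last (x # w) = v"
      using t by (auto simp: trail_def)
    obtain M' where M': "M = P + M'" using PQ(1) by (auto simp: mset_subset_eq_exists_conv)
    obtain N' where N': "N = Q + N'" using PQ(2) by (auto simp: mset_subset_eq_exists_conv)
    have cPQ: "count (\<Sum>\<^sub># P) u + (if u = v then 1 else 0)
      = count (\<Sum>\<^sub># Q) u + (if u = y then 1 else 0)" for u
      using arg_cong[OF trans[OF Pw Qw[symmetric]], of "\<lambda>m. count m u"]
        by (auto split: if_splits)
    have szPQ: "size P = size Q" using sizes[OF t] .
    \<comment> \<open>Otherwise replacing P by Q in M gives k edges of a - b that spare a copy of y,
      against \<open>no_M\<close>.\<close>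
    have "v \<in># \<Sum>\<^sub># M'"
    proof (rule ccontr)
      assume "v \<notin># \<Sum>\<^sub># M'"
      then have 0: "count (\<Sum>\<^sub># M') v = 0"
        by (simp only: count_eq_zero_iff not_False_eq_True)
      have bv: "count b v = 0" using v by (simp add: not_in_iff)
      have "\<Sum>\<^sub># (M' + Q) \<subseteq># a - b - {#y#}"
      proof (rule mset_subset_eqI)
        fix u
        have "count (\<Sum>\<^sub># M') u + count (\<Sum>\<^sub># Q) u + (if u
          = y then 1 else 0) \<le> count a u - count b u"
        proof (cases "u = v")
          case True
          have "count (\<Sum>\<^sub># Q) v \<le> count (\<Sum>\<^sub># N) v" by (simp add: N')
          then show ?thesis using True 0 bv Na[of v] by auto
        next
          case False
          then show ?thesis using cPQ[of u] Ma[of u] by (simp add: M')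
        qed
        then show "count (\<Sum>\<^sub># (M' + Q)) u \<le> count (a - b - {#y#}) u"
          by (auto split: if_splits)
      qed
      moreover have "matching (M' + Q)" "size (M' + Q) = k"
        using M N szPQ by (auto simp: M' N')
      ultimately show False using no_M unfolding packs_def by blast
    qed
    then obtain z where z: "{#v, z#} \<in># M'" "adj v z"
      using M(1) matching_edge_at[of M' v] by (auto simp: M')
    then obtain M'' where M'': "M' = add_mset {#v, z#} M''" by (blast dest: multi_member_split)
    \<comment> \<open>Otherwise replacing Q in N by P and the edge vz gives s + 1 edges in
      a.\<close>
    have "z \<in># \<Sum>\<^sub># N'"
    proof (rule ccontr)
      assume "z \<notin># \<Sum>\<^sub># N'"
      then have 0: "count (\<Sum>\<^sub># N') z = 0"
        by (simp only: count_eq_zero_iff not_False_eq_True)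
      have "\<Sum>\<^sub># (N' + add_mset {#v, z#} P) \<subseteq># a"
      proof (rule mset_subset_eqI)
        fix u
        have "count (\<Sum>\<^sub># N') u + count (\<Sum>\<^sub># P) u + (if u
          = v then 1 else 0) + (if u = z then 1 else 0) \<le> count a u"
        proof (cases "u = z")
          case True
          have "count (\<Sum>\<^sub># P) z + (if z
            = v then 1 else 0) + 1 \<le> count (\<Sum>\<^sub># M) z"
            by (auto simp: M' M'')
          then show ?thesis using True 0 Ma[of z] by auto
        next
          case False
          then show ?thesis using cPQ[of u] Na[of u] by (simp add: N')
        qed
        then show "count (\<Sum>\<^sub># (N' + add_mset {#v, z#} P)) u \<le> count a u"
          by (auto split: if_splits)
      qed
      moreover have "matching (N' + add_mset {#v, z#} P)"
        using M N z(2) by (auto simp: M' N')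
      moreover have "size (N' + add_mset {#v, z#} P) = Suc s" using N szPQ by (simp add: N')
      ultimately show False using a(1) unfolding packs_def by blast
    qed
    then obtain v' where v': "{#z, v'#} \<in># N'" "adj z v'"
      using N(1) matching_edge_at[of N' z] by (auto simp: N')
    then obtain N'' where N'': "N' = add_mset {#z, v'#} N''" by (blast dest: multi_member_split)
    define P' Q' where "P' = add_mset {#v, z#} P" and "Q' = add_mset {#z, v'#} Q"
    have P'w: "\<Sum>\<^sub># P' = mset (w @ [z])" using Pw by (simp add: P'_def)
    have mP': "matching P'" using M(1) z(2) by (auto simp: P'_def M')
    have "w \<noteq> []" using Pw by auto
    then have succ: "successively adj (x # (w @ [z]) @ [v'])"
      using w z(2) v'(2) by (auto simp: successively_append_iff successively_Cons split: if_splits)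
    show ?thesis
    proof (cases "v' \<in># b")
      case True
      have len: "length (w @ [z]) = 2 * size P'"
        using size_Union_matching[OF mP'] P'w by (metis size_mset)
      have "y \<in># mset w" unfolding Qw[symmetric] by simp
      then have "y \<in> set (w @ [z])" by simp
      moreover have "mset (w @ [z]) \<subseteq># a - b"
        using M(3) unfolding P'w[symmetric]
          by (auto simp: M' M'' P'_def intro: subset_mset.order_trans[rotated])
      moreover have "size P' \<le> k" using M by (auto simp: P'_def M' M'')
      moreover have "packs (k - size P') (a - b - mset (w @ [z]))"
        unfolding packs_def
      proof (intro exI conjI)
        show "matching M''" "size M'' = k - size P'" using M by (auto simp: P'_def M' M'')
        have "\<Sum>\<^sub># M'' + \<Sum>\<^sub># P' \<subseteq># a - b" using M(3)
          by (simp add: M' M'' P'_def ac_simps)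
        then obtain L where "a - b = \<Sum>\<^sub># M'' + \<Sum>\<^sub># P' + L"
          by (auto simp: mset_subset_eq_exists_conv)
        then show "\<Sum>\<^sub># M'' \<subseteq># a - b - mset (w @ [z])"
          unfolding P'w[symmetric] by simp
      qed
      ultimately show ?thesis
        using none True succ unfolding len[symmetric]
        by (metis dvd_triv_left len nonzero_mult_div_cancel_left zero_neq_numeral)
    next
      case False
      have "trail P' Q' (w @ [z, v']) v'"
        using False succ Pw Qw by (auto simp: trail_def P'_def Q'_def M' M'' N' N'')
      then show ?thesis by (intro exI[of _ P'] exI[of _ Q'] exI) (auto simp: Q'_def)
    qed
  qed
  have init: "trail {#} {#} [y] y"
    using x y by (auto simp: trail_def)
  \<comment> \<open>Each extension uses one more edge of N, so unbounded trails contradict the size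
    of N.\<close>
  have "\<exists>P Q w v. trail P Q w v \<and> size Q = n" for n
  proof (induction n)
    case 0
    have "trail {#} {#} [y] y \<and> size {#} = 0" using init by simp
    then show ?case by (intro exI)
  next
    case (Suc n)
    then obtain P Q w v where "trail P Q w v" "size Q = n" by blast
    then show ?case using extend[of P Q w v] by blast
  qed
  then obtain P Q w v where "trail P Q w v" "size Q = Suc (size N)" by blast
  then show False using size_mset_mono[of Q N] by (auto simp: trail_def)
qed


text \<open>A factor-critical b is grown inside C by ears as long as it misses a vertex of C. The
  weight k is only bounded by (size b - 1)/2, since cutting walks may lose weight. The vertices r
  and r' exclude a one-vertex C, which has no odd closed walk.\<close>

lemma component_ear_decomp:
  assumes a: "\<not> packs (Suc s) a" "\<And>i. i \<in># a \<Longrightarrow> packs s (a - {#i#})"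
    and C: "C \<subseteq> set_mset a"
    and closed: "\<And>u v. u \<in> C \<Longrightarrow> v \<in># a \<Longrightarrow> adj u v
      \<Longrightarrow> v \<in> C"
    and conn: "\<And>T. T \<subset> C \<Longrightarrow> T \<noteq> {}
      \<Longrightarrow> \<exists>x\<in>T. \<exists>y\<in>C - T. adj x y"
    and edge: "r \<in> C" "r' \<in> C" "r \<noteq> r'"
  shows "\<exists>b k ws. b \<subseteq># a \<and> factor_critical b \<and> set_mset b = C
    \<and> ear_decomp C k ws \<and>
    2 * k + 1 \<le> size b \<and> odd (size b)"
proof -
  \<comment> \<open>j + k = s means that some largest packing of a consists of j edges matching b
    minus one element and k edges off b. The seed is a separate case because a single vertex has no
    ear decomposition.\<close>
  define extendable where "extendable b \<longleftrightarrow> b \<subseteq># a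
    \<and> factor_critical b \<and> set_mset b \<subseteq> C \<and>
    (\<exists>j k. size b = 2 * j + 1 \<and> packs k (a - b) \<and> j + k = s \<and>
      (b = {#r#} \<or> (\<exists>i ws. ear_decomp (set_mset b) i ws \<and> i \<le> j)))" for b
  have walk_in_C: "set w \<subseteq> C" if "successively adj (x # w)" "x \<in> C"
    "set w \<subseteq> set_mset a" for x w
    using that by (induction w arbitrary: x) (auto simp: successively_Cons dest: closed)
  have grow: "\<exists>b'. extendable b' \<and> set_mset b \<subset> set_mset b'"
    if b: "extendable b" "set_mset b \<noteq> C" for b
  proof -
    obtain j k where jk: "size b = 2 * j + 1" "packs k (a - b)" "j + k = s"
      and ears: "b = {#r#} \<or> (\<exists>i ws. ear_decomp (set_mset b) i ws \<and> i \<le> j)"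
      using b(1) by (auto simp: extendable_def)
    have bb: "b \<subseteq># a" "factor_critical b" "set_mset b \<subseteq> C" using b(1)
      by (auto simp: extendable_def)
    then obtain x y where xy: "x \<in># b" "y \<in> C" "y \<notin># b" "adj x y"
      using conn[of "set_mset b"] b(2) by (auto simp: factor_critical_def)
    obtain w z where w: "z \<in># b" "successively adj (x # w @ [z])" "even (length w)"
      "y \<in> set w"
      "mset w \<subseteq># a - b" "length w div 2 \<le> k"
        "packs (k - length w div 2) (a - b - mset w)"
      using factor_critical_ear_exists[OF a(1) a(2) _ xy(3) bb(2,1) jk xy(1,4)] xy(2) C by blast
    have sub: "b + mset w \<subseteq># a"
      using w(5) bb(1) by (metis add.commute subset_eq_diff_conv subset_mset.le_diff_conv2)
    have setw: "set w \<subseteq> C"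
    proof (rule walk_in_C)
      show "successively adj (x # w)"
        using w(2) successively_middle[of adj "[]" "x # w" "[z]"] by simp
      show "x \<in> C" using xy bb by auto
      show "set w \<subseteq> set_mset a" using sub
        by (metis mset_subset_eqD set_mset_mset subsetI union_iff)
    qed
    have "\<exists>i ws. ear_decomp (set_mset (b + mset w)) i ws \<and> i \<le> j + length w div 2"
    proof (cases "b = {#r#}")
      case True
      \<comment> \<open>From the seed both ends of the new walk are r, so it is an odd closed walk
        and starts the decomposition.\<close>
      then have xz: "x = r" "z = r" using xy w by auto
      have "\<exists>i ws. ear_decomp (set (r # w @ [r])) i ws
        \<and> i \<le> (length (r # w @ [r]) - 1) div 2"
        by (rule ear_decomp_odd_closed_walk) (use w xz in auto)
      then show ?thesis using True w(3) by (auto simp: insert_absorb)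
    next
      case False
      then obtain i ws where i: "ear_decomp (set_mset b) i ws" "i \<le> j" using ears by auto
      have "\<exists>i' ws'. ear_decomp (set_mset b \<union> set (x # w @ [z])) i' ws'
        \<and> i' \<le> i + (length (x # w @ [z]) - 1) div 2"
        by (rule ear_decomp_absorb[OF i(1) w(2)]) (use w xy in auto)
      moreover have "set_mset b \<union> set (x # w @ [z]) = set_mset (b + mset w)"
        using w xy by auto
      moreover have "(length (x # w @ [z]) - 1) div 2 = length w div 2" using w(3) by simp
      ultimately show ?thesis using i(2) by (metis add_le_mono1 order_trans)
    qed
    moreover have "size (b + mset w) = 2 * (j + length w div 2) + 1" using jk w(3) by auto
    moreover have "a - (b + mset w) = a - b - mset w" by simp
    moreover have "(j + length w div 2) + (k - length w div 2) = s" using jk w(6) by simp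
    ultimately have "extendable (b + mset w)"
      unfolding extendable_def using sub setw bb(3) factor_critical_ear[OF bb(2) xy(1) w(1-3)] w(7)
      by (metis set_mset_mset set_mset_union Un_least)
    moreover have "set_mset b \<subset> set_mset (b + mset w)" using w(4) xy(3) by auto
    ultimately show ?thesis by blast
  qed
  have init: "extendable {#r#}"
    unfolding extendable_def using edge C a(2)[of r] by (auto intro!: exI[of _ 0])
  have "\<exists>b'. extendable b' \<and> set_mset b' = C" if "extendable b" for b
    using that
  proof (induction "card (C - set_mset b)" arbitrary: b rule: less_induct)
    case less
    show ?case
    proof (cases "set_mset b = C")
      case False
      then obtain b' where b': "extendable b'" "set_mset b \<subset> set_mset b'"
        using grow less.prems by blast
      have "finite C" using C finite_subset by blast
      moreover have "set_mset b' \<subseteq> C" using b' by (simp add: extendable_def)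
      ultimately have "card (C - set_mset b') < card (C - set_mset b)"
        using b'(2) by (intro psubset_card_mono) auto
      then show ?thesis using less.hyps b'(1) by blast
    qed (use less.prems in blast)
  qed
  then obtain b where b: "extendable b" "set_mset b = C" using init by blast
  moreover have "b \<noteq> {#r#}" using b(2) edge by auto
  ultimately show ?thesis unfolding extendable_def by fastforce
qed

text \<open>Connectivity of C is stated as the absence of an empty cut between T and C - T, the form
  in which growth arguments use it.\<close>

definition components :: "'v set \<Rightarrow> 'v set set \<Rightarrow> bool" where
  "components U Cs \<longleftrightarrow> finite Cs \<and> \<Union>Cs = U \<and> {} \<notin> Cs
    \<and> disjoint Cs \<and>
     (\<forall>C\<in>Cs. \<forall>u\<in>C. \<forall>v\<in>U. adj u v \<longrightarrow> v \<in> C)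
       \<and>
     (\<forall>C\<in>Cs. \<forall>T. T \<subset> C \<longrightarrow> T \<noteq> {} \<longrightarrow>
       (\<exists>x\<in>T. \<exists>y\<in>C - T. adj x y))"

lemma componentsD:
  assumes "components U Cs"
  shows "finite Cs" "\<Union>Cs = U" "{} \<notin> Cs" "disjoint Cs"
    "\<And>C u v. C \<in> Cs \<Longrightarrow> u \<in> C \<Longrightarrow> v \<in> U
      \<Longrightarrow> adj u v \<Longrightarrow> v \<in> C"
    "\<And>C T. C \<in> Cs \<Longrightarrow> T \<subset> C \<Longrightarrow> T \<noteq> {}
      \<Longrightarrow> \<exists>x\<in>T. \<exists>y\<in>C - T. adj x y"
  using assms unfolding components_def by simp_all

lemma sum_component_multisets:
  assumes "disjoint Cs" "finite Cs" "\<And>C. C \<in> Cs \<Longrightarrow> set_mset (b C)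
    \<subseteq> C" "C \<in> Cs" "u \<in> C"
  shows "count (\<Sum>C\<in>Cs. b C) u = count (b C) u"
proof -
  have "count (b D) u = 0" if "D \<in> Cs - {C}" for D
  proof -
    have "u \<notin> D" using that assms(1,4,5) by (auto simp: disjoint_def)
    then show ?thesis using assms(3) that by (metis DiffD1 not_in_iff subsetD)
  qed
  then show ?thesis
    using assms(2,4) by (simp add: count_sum sum.remove[of Cs C])
qed

lemma size_sum: "size ((\<Sum>i\<in>I. f i) :: 'b multiset) = (\<Sum>i\<in>I. size (f i))"
  by (induction I rule: infinite_finite_induct) auto

text \<open>The factor-critical pieces of the components have disjoint supports, so with one element
  deleted from each they are matched together inside one critical multiset; its packing number
  bounds the total weight. Cs is quantified inside because U is produced here and its components can
  only be named afterwards.\<close>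

lemma dominating_ear_decomp:
  assumes a: "\<not> packs t a" "\<And>i. i \<in> c \<Longrightarrow> packs t (add_mset i a)"
    and ac: "set_mset a \<subseteq> c"
  shows "\<exists>U \<subseteq> c. (\<forall>i \<in> c. \<exists>u \<in> U. adj i u) \<and>
    (\<forall>Cs. components U Cs \<longrightarrow>
      (\<exists>k ws. (\<forall>C \<in> Cs. ear_decomp C (k C) (ws C)) \<and> (\<Sum>C\<in>Cs. k C)
        < t))"
proof -
  obtain a' t' where a': "a' \<subseteq># a" "t' \<le> t" "\<not> packs t' a'"
    "\<forall>i \<in> c. packs t' (add_mset i a')"
      "\<forall>i \<in># a'. packs (t' - 1) (a' - {#i#})"
    using packs_descent[OF a] by blast
  have "t' \<noteq> 0" using a'(3) by (metis packs_zero)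
  then obtain s where s: "t' = Suc s" by (cases t') auto
  define U where "U = set_mset a'"
  have Uc: "U \<subseteq> c" using a'(1) ac by (auto simp: U_def dest: mset_subset_eqD)
  have dom: "\<exists>u \<in> U. adj i u" if "i \<in> c" for i
    using packs_new_neighbour[OF a'(3)] a'(4) that by (metis U_def)
  have "\<exists>k ws. (\<forall>C \<in> Cs. ear_decomp C (k C) (ws C))
    \<and> (\<Sum>C\<in>Cs. k C) < t" if "components U Cs" for Cs
  proof -
    note Cs = componentsD[OF that]
    have "\<exists>b k ws. b \<subseteq># a' \<and> factor_critical b \<and> set_mset b = C
      \<and> ear_decomp C k ws \<and>
        2 * k + 1 \<le> size b \<and> odd (size b)" if C: "C \<in> Cs" for C
    proof -
      obtain r where r: "r \<in> C" using Cs(3) C by (metis ex_in_conv)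
      then have rU: "r \<in> U" using Cs(2) C by blast
      \<comment> \<open>Vertices of U have neighbours in U as well, so no component is a single
        vertex.\<close>
      then obtain r' where r': "r' \<in> U" "adj r r'" using dom Uc by blast
      have rr: "r' \<in> C" "r \<noteq> r'" using Cs(5)[OF C r r'] r' adj_irrefl by auto
      show ?thesis
      proof (rule component_ear_decomp[of s a' C r r'])
        show "\<not> packs (Suc s) a'" using a'(3) s by simp
        show "packs s (a' - {#i#})" if "i \<in># a'" for i using a'(5) that s by simp
        show "C \<subseteq> set_mset a'" using Cs(2) C U_def by blast
        show "v \<in> C" if "u \<in> C" "v \<in># a'" "adj u v" for u v
          using Cs(5)[OF C that(1) _ that(3)] that(2) U_def by blast
        show "\<exists>x\<in>T. \<exists>y\<in>C - T. adj x y" if "T \<subset> C" "T \<noteq> {}"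
          for T
          using Cs(6)[OF C that] .
      qed (use r rr in auto)
    qed
    then obtain b k ws where b: "\<And>C. C \<in> Cs \<Longrightarrow> b C \<subseteq># a'
      \<and> factor_critical (b C) \<and> set_mset (b C) = C \<and>
      ear_decomp C (k C) (ws C) \<and> 2 * k C + 1 \<le> size (b C) \<and> odd (size (b C))"
      by metis
    obtain p where p: "\<And>C. C \<in> Cs \<Longrightarrow> p C \<in> C"
      using Cs(3) by (metis ex_in_conv)
    define m where "m C = b C - {#p C#}" for C
    have m: "m C \<subseteq># a'" "set_mset (m C) \<subseteq> C" "2 * k C \<le> size (m C)"
      "perfect (m C)" if "C \<in> Cs" for C
      using b[OF that] p[OF that] unfolding m_def factor_critical_def
      by (auto intro: subset_mset.order_trans diff_subset_eq_self simp: size_Diff_singleton dest: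
        in_diffD)
    have sub: "(\<Sum>C\<in>Cs. m C) \<subseteq># a'"
    proof (rule mset_subset_eqI)
      fix u
      show "count (\<Sum>C\<in>Cs. m C) u \<le> count a' u"
      proof (cases "u \<in> U")
        case True
        then obtain C where "C \<in> Cs" "u \<in> C" using Cs(2) by blast
        then show ?thesis
          using sum_component_multisets[OF Cs(4,1) m(2)] m(1) by (metis mset_subset_eq_count)
      next
        case False
        then have "u \<notin># m C" if "C \<in> Cs" for C using m(2) that Cs(2) by blast
        then show ?thesis by (simp add: count_sum not_in_iff)
      qed
    qed
    have perf: "perfect (\<Sum>C\<in>Cs. m C)" using m(4) by (rule perfect_sum)
    then obtain M where M: "matching M" "\<Sum>\<^sub># M = (\<Sum>C\<in>Cs. m C)"
      by (auto simp: perfect_def)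
    then have "2 * size M = (\<Sum>C\<in>Cs. size (m C))" using size_Union_matching size_sum
      by metis
    moreover have "(\<Sum>C\<in>Cs. 2 * k C) \<le> (\<Sum>C\<in>Cs. size (m C))" using m(3)
      by (rule sum_mono)
    ultimately have "(\<Sum>C\<in>Cs. k C) \<le> size M" by (simp flip: sum_distrib_left)
    moreover have "packs (size M) a'" using M sub by (auto simp: packs_def)
    ultimately have "packs (\<Sum>C\<in>Cs. k C) a'" using packs_antimono by blast
    then have "(\<Sum>C\<in>Cs. k C) < t" using a'(2,3) packs_antimono by (meson le_trans not_le)
    then show ?thesis using b by blast
  qed
  then show ?thesis using Uc dom by blast
qed

section \<open>Critical multisets from ear decompositions\<close>

lemma size_matching_le_components:
  assumes "components U Cs" "matching M" "\<Sum>\<^sub># M \<subseteq># a"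
    "set_mset a \<subseteq> U"
  shows "size M \<le> (\<Sum>C\<in>Cs. size (filter_mset (\<lambda>v. v \<in> C) a) div 2)"
  using assms(2-)
proof (induction M arbitrary: a)
  case (add e M)
  obtain u v where e: "e = {#u, v#}" "adj u v" using add.prems(1) by auto
  obtain a' where a: "a = add_mset u (add_mset v a')" and a': "\<Sum>\<^sub># M \<subseteq># a'"
    using add.prems(2) by (auto simp: e mset_subset_eq_exists_conv)
  note Cs = componentsD(1,2,4,5)[OF assms(1)]
  have uv: "u \<in> U" "v \<in> U" using add.prems(3) by (auto simp: a)
  then obtain C where C: "C \<in> Cs" "u \<in> C" using Cs(2) by blast
  then have vC: "v \<in> C" using Cs(4) uv e by blast
  let ?f = "\<lambda>a C. size (filter_mset (\<lambda>v. v \<in> C) a) div 2"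
  have "?f a D = ?f a' D" if "D \<in> Cs - {C}" for D
  proof -
    have "u \<notin> D" "v \<notin> D" using that C vC Cs(3) by (auto simp: disjoint_def)
    then show ?thesis by (simp add: a)
  qed
  \<comment> \<open>Both ends of e lie in C, so removing e lowers this one summand by exactly
    one.\<close>
  then have "(\<Sum>D\<in>Cs. ?f a D) = Suc (\<Sum>D\<in>Cs. ?f a' D)"
    using C vC Cs(1) by (simp add: sum.remove[of Cs C] a)
  moreover have "size M \<le> (\<Sum>D\<in>Cs. ?f a' D)"
    using add.IH[of a'] add.prems a' by (auto simp: a)
  ultimately show ?case by simp
qed auto

text \<open>Each component carries 2k' + 1 elements and the k' sum to t - 1, so at most t - 1 edges
  fit into a. Once i is added, a neighbour u of i is deleted from its component and some vertex from
  every other one; the rest has a perfect matching with t - 1 edges, and iu is one more.\<close>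

lemma critical_of_ear_decomp:
  assumes U: "components U Cs" "U \<noteq> {}"
    and ears: "\<And>C. C \<in> Cs \<Longrightarrow> ear_decomp C (k C) (ws C)"
      and t: "(\<Sum>C\<in>Cs. k C) < t"
    and dom: "\<And>i. i \<in> c \<Longrightarrow> i \<in> U \<or> (\<exists>u \<in> U. adj i u)"
  shows "\<exists>a. set_mset a = U \<and> \<not> packs t a \<and> (\<forall>i
    \<in> c. packs t (add_mset i a))"
proof -
  note Cs = componentsD(1,2,4)[OF U(1)]
  obtain C0 where C0: "C0 \<in> Cs" using U(2) Cs(2) by blast
  \<comment> \<open>The gap between the total weight and t - 1, filled by enlarging the single
    component C0.\<close>
  define x where "x = t - 1 - (\<Sum>C\<in>Cs. k C)"
  define k' where "k' C = (if C = C0 then k C + x else k C)" for C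
  have k': "(\<Sum>C\<in>Cs. k' C) = t - 1"
  proof -
    have "(\<Sum>C\<in>Cs. k' C) = (\<Sum>C\<in>Cs. k C) + x"
      using C0 Cs(1) by (simp add: k'_def sum.remove[of Cs C0])
    then show ?thesis using t by (simp add: x_def)
  qed
  have "\<exists>b. factor_critical b \<and> set_mset b = C \<and> size b = 2 * k' C + 1
    \<and> (\<exists>u v. u \<in> C \<and> v \<in> C \<and> u \<noteq> v)"
    if C: "C \<in> Cs" for C
  proof -
    obtain b u v where b: "factor_critical b" "set_mset b = C" "size b = 2 * k C + 1" "u \<in> C"
      "v \<in> C" "u \<noteq> v"
      using ear_decomp_factor_critical[OF ears[OF C]] by blast
    then obtain b' where "factor_critical b'" "set_mset b' = C"
      "size b' = size b + 2 * (k' C - k C)"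
      using factor_critical_enlarge[of b u v] by metis
    then show ?thesis using b by (intro exI[of _ b']) (auto simp: k'_def)
  qed
  then obtain b u1 u2 where b: "\<And>C. C \<in> Cs \<Longrightarrow> factor_critical (b C)"
    "\<And>C. C \<in> Cs \<Longrightarrow> set_mset (b C) = C"
    "\<And>C. C \<in> Cs \<Longrightarrow> size (b C) = 2 * k' C + 1"
    and u12: "\<And>C. C \<in> Cs \<Longrightarrow> u1 C \<in> C \<and> u2 C \<in> C
      \<and> u1 C \<noteq> u2 C"
    by metis
  define a where "a = (\<Sum>C\<in>Cs. b C)"
  have count_a: "count a u = count (b C) u" if "C \<in> Cs" "u \<in> C" for C u
    using sum_component_multisets[OF Cs(3,1), of b C u] b(2) that by (auto simp: a_def)
  have set_a: "set_mset a = U"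
    using b(2) Cs(1,2) by (auto simp: a_def set_mset_sum)
  have "filter_mset (\<lambda>v. v \<in> C) a = b C" if "C \<in> Cs" for C
  proof (rule multiset_eqI)
    fix u show "count (filter_mset (\<lambda>v. v \<in> C) a) u = count (b C) u"
    proof (cases "u \<in> C")
      case True
      then show ?thesis using count_a[OF that, of u] by simp
    next
      case False
      then have "u \<notin># b C" using b(2)[OF that] by blast
      then show ?thesis using False by (simp add: not_in_iff)
    qed
  qed
  then have "(\<Sum>C\<in>Cs. size (filter_mset (\<lambda>v. v \<in> C) a) div 2) = t - 1"
    using b(3) k' by simp
  then have "\<not> packs t a"
    using size_matching_le_components[OF U(1), of _ a] set_a t unfolding packs_def by force
  moreover have "packs t (add_mset i a)" if i: "i \<in> c" for i
  proof -
    have "\<exists>u \<in> U. adj i u"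
    proof (cases "i \<in> U")
      case True
      then obtain C where C: "C \<in> Cs" "i \<in> C" using Cs(2) by blast
      obtain u where "u \<in># b C" "adj i u"
        using factor_critical_neighbour[OF b(1)[OF C(1)], of i "u1 C"]
          factor_critical_neighbour[OF b(1)[OF C(1)], of i "u2 C"] b(2) C u12[OF C(1)] by metis
      then show ?thesis using b(2) C Cs(2) by blast
    qed (use dom i in blast)
    then obtain u where u: "u \<in> U" "adj i u" by blast
    then obtain C where C: "C \<in> Cs" "u \<in> C" using Cs(2) by blast
    define q where "q D = (if D = C then u else u1 D)" for D
    have q: "q D \<in># b D" if "D \<in> Cs" for D using that b(2) u12 C by (auto simp: q_def)
    have perf: "perfect (b D - {#q D#})" if "D \<in> Cs" for D
      using b(1)[OF that] q[OF that] by (auto simp: factor_critical_def)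
    have "perfect (\<Sum>D\<in>Cs. b D - {#q D#})" using perf by (rule perfect_sum)
    moreover have "size (\<Sum>D\<in>Cs. b D - {#q D#}) = 2 * (t - 1)"
      using b(3) q k' by (simp add: size_sum size_Diff_singleton flip: sum_distrib_left)
    ultimately have 1: "packs (t - 1) (\<Sum>D\<in>Cs. b D - {#q D#})" by (rule perfect_packs)
    have "a = (\<Sum>D\<in>Cs. (b D - {#q D#}) + {#q D#})" unfolding a_def
      using q by (intro sum.cong) auto
    also have "\<dots> = (\<Sum>D\<in>Cs. b D - {#q D#}) + (\<Sum>D\<in>Cs. {#q D#})"
      by (rule sum.distrib)
    also have "(\<Sum>D\<in>Cs. {#q D#}) = {#u#} + (\<Sum>D\<in>Cs - {C}. {#q D#})"
      using C Cs(1) by (simp add: sum.remove[of Cs C] q_def)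
    finally have "(\<Sum>D\<in>Cs. b D - {#q D#}) + {#i, u#} \<subseteq># add_mset i a"
      by (simp add: ac_simps)
    moreover have "packs (t - 1 + 1) ((\<Sum>D\<in>Cs. b D - {#q D#}) + {#i, u#})"
      using 1 packs_edge[OF u(2)] by (rule packs_add)
    ultimately show ?thesis using t packs_mono by simp
  qed
  ultimately show ?thesis using set_a by blast
qed

end

section \<open>Covers and cores\<close>

locale finite_adjacency = adjacency adj for adj :: "'v \<Rightarrow> 'v \<Rightarrow> bool" +
  fixes V :: "'v set"
  assumes finite_V: "finite V" and adj_in_V: "adj u v \<Longrightarrow> u \<in> V"
begin

lemma adj_in_V': "adj u v \<Longrightarrow> v \<in> V"
  using adj_in_V adj_sym by blast

definition cover :: "'v set \<Rightarrow> bool" where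
  "cover F \<longleftrightarrow> F \<subseteq> V \<and> (\<forall>u v. adj u v \<longrightarrow> u
    \<in> F \<or> v \<in> F)"

definition core :: "'v set \<Rightarrow> 'v set" where
  "core F = {v \<in> F. \<forall>u \<in> V - F. \<not> adj v u}"

text \<open>The equation I^t : x^a = P_F tested on monomials x^k.\<close>

definition colon_witness :: "nat \<Rightarrow> 'v set \<Rightarrow> 'v multiset \<Rightarrow> bool"
  where
  "colon_witness t F a \<longleftrightarrow> set_mset a \<subseteq> V \<and>
     (\<forall>k. set_mset k \<subseteq> V \<longrightarrow> (packs t (a + k) \<longleftrightarrow>
       set_mset k \<inter> F \<noteq> {}))"

lemma core_empty_iff:
  assumes "cover F" shows "core F = {} \<longleftrightarrow> \<not> (\<exists>F'. F' \<subset> F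
    \<and> cover F')"
proof
  assume "core F = {}"
  show "\<not> (\<exists>F'. F' \<subset> F \<and> cover F')"
  proof
    assume "\<exists>F'. F' \<subset> F \<and> cover F'"
    then obtain F' v where F': "F' \<subset> F" "cover F'" "v \<in> F" "v \<notin> F'" by blast
    then obtain u where "u \<in> V - F" "adj v u" using \<open>core F = {}\<close>
      by (auto simp: core_def)
    then show False using F' by (auto simp: cover_def)
  qed
next
  assume *: "\<not> (\<exists>F'. F' \<subset> F \<and> cover F')"
  have "\<not> v \<in> core F" for v
  proof
    assume v: "v \<in> core F"
    have "u \<in> F - {v} \<or> w \<in> F - {v}" if "adj u w" for u w
      using that v assms adj_in_V adj_in_V' adj_irrefl adj_sym unfolding core_def cover_def by blast
    then have "cover (F - {v})" using assms by (auto simp: cover_def)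
    then show False using * v by (auto simp: core_def)
  qed
  then show "core F = {}" by blast
qed

text \<open>For an edge uv missed by F, let k be t copies of uv: x^k lies in I^t although it is not
  in P_F.\<close>

lemma colon_witness_cover:
  assumes "colon_witness t F a" "F \<subseteq> V" shows "cover F"
  unfolding cover_def
proof (intro conjI allI impI)
  fix u v assume uv: "adj u v"
  show "u \<in> F \<or> v \<in> F"
  proof (rule ccontr)
    assume *: "\<not> (u \<in> F \<or> v \<in> F)"
    have "packs n (repeat_mset n {#u, v#})" for n
    proof (induction n)
      case (Suc n)
      then have "packs (1 + n) ({#u, v#} + repeat_mset n {#u, v#})"
        using packs_edge[OF uv] by (intro packs_add)
      then show ?case by (simp add: add_mset_commute)
    qed auto
    then have "packs t (a + repeat_mset t {#u, v#})"
      using packs_mono mset_subset_eq_add_right by blast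
    moreover have "set_mset (repeat_mset t {#u, v#}) \<subseteq> {u, v}" by (cases t) auto
    ultimately show False
      using assms(1) * adj_in_V[OF uv] adj_in_V'[OF uv] unfolding colon_witness_def by blast
  qed
qed (fact assms)

lemma size_matching_le_touching:
  assumes "matching M" "\<And>e. e \<in># M \<Longrightarrow> \<exists>v \<in># e. v \<in> N"
  shows "size M \<le> size (filter_mset (\<lambda>v. v \<in> N) (\<Sum>\<^sub># M))"
  using assms
proof (induction M)
  case (add e M)
  obtain v where "v \<in># e" "v \<in> N" using add.prems(2)[of e] by auto
  then have "v \<in># filter_mset (\<lambda>v. v \<in> N) e" by simp
  then have "1 \<le> size (filter_mset (\<lambda>v. v \<in> N) e)"
    by (metis One_nat_def Suc_leI size_eq_0_iff_empty neq0_conv multi_member_skip empty_iff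
      set_mset_empty)
  moreover have "size M \<le> size (filter_mset (\<lambda>v. v \<in> N) (\<Sum>\<^sub># M))"
    using add by simp
  ultimately show ?case by simp
qed simp

text \<open>
  The vertices of \<open>F\<close> outside the core can all be matched to the complement of \<open>F\<close>, and every
  edge outside the core uses one of them: so they contribute a constant to all matching numbers.
\<close>
lemma core_critical:
  assumes a: "colon_witness t F a" and F: "cover F"
  shows "\<exists>a' t'. set_mset a' \<subseteq> core F \<and> t' \<le> t
    \<and> \<not> packs t' a' \<and>
    (\<forall>i \<in> core F. packs t' (add_mset i a'))"
proof -
  define N where "N = F - core F"
  define y where "y = size (filter_mset (\<lambda>v. v \<in> N) a)"
  define a' where "a' = filter_mset (\<lambda>v. v \<in> core F) a"
  have FV: "F \<subseteq> V" using F by (simp add: cover_def)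
  have "\<exists>g. \<forall>v \<in> N. g v \<in> V - F \<and> adj v (g v)"
    unfolding N_def core_def by (intro bchoice) blast
  then obtain g where g: "\<And>v. v \<in> N \<Longrightarrow> g v \<in> V - F \<and> adj v (g v)"
    by blast
  \<comment> \<open>x^k is supported outside F, so multiplying by it keeps x^a out of I^t, while k
    supplies a separate partner for each element of a in N.\<close>
  define k where "k = image_mset g (filter_mset (\<lambda>v. v \<in> N) a)"
  have lower: "packs (t' + y) (a + k)" if "packs t' a'" for t'
  proof -
    have "packs (size b) (b + image_mset g b)" if "set_mset b \<subseteq> N" for b
      using that
    proof (induction b)
      case (add v b)
      then have "packs (1 + size b) ({#v, g v#} + (b + image_mset g b))"
        using g[of v] by (intro packs_add packs_edge) auto
      then show ?case by (simp add: add_mset_commute)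
    qed auto
    then have "packs y (filter_mset (\<lambda>v. v \<in> N) a + k)"
      unfolding y_def k_def by (metis (no_types, lifting) filter_mset_eq_conv subsetI)
    then have "packs (t' + y) (a' + (filter_mset (\<lambda>v. v \<in> N) a + k))"
      using that by (intro packs_add)
    moreover have "a' + filter_mset (\<lambda>v. v \<in> N) a \<subseteq># a"
      unfolding a'_def N_def by (rule mset_subset_eqI) auto
    ultimately show ?thesis by (metis packs_mono add.assoc mset_subset_eq_mono_add_right_cancel)
  qed
  have "set_mset k \<subseteq> V - F" using g by (auto simp: k_def)
  then have "\<not> packs t (a + k)" using a unfolding colon_witness_def by blast
  \<comment> \<open>The subtraction is truncated, but \<open>t \<le> t - y + y\<close> holds in
    either case.\<close>
  then have not: "\<not> packs (t - y) a'"
    using lower[of "t - y"] packs_antimono[of "t - y + y" "a + k" t] by linarith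
  have upper: "packs (t - y) (add_mset i a')" if i: "i \<in> core F" for i
  proof -
    have "i \<in> F" "i \<in> V" using i FV by (auto simp: core_def)
    then have "packs t (a + {#i#})"
      using a[unfolded colon_witness_def, THEN conjunct2, THEN spec, of "{#i#}"] by simp
    then obtain M where M: "matching M" "size M = t" "\<Sum>\<^sub># M \<subseteq># add_mset i a"
      by (auto simp: packs_def)
    define P where "P e \<longleftrightarrow> set_mset e \<subseteq> core F" for e
    define M1 M2 where "M1 = filter_mset P M" and "M2 = filter_mset (\<lambda>e. \<not> P e) M"
    have M12: "M = M1 + M2" by (simp add: M1_def M2_def)
    have m12: "matching M1" "matching M2" using M(1) M12 by auto
    \<comment> \<open>If an end of the edge lies outside F, the other end is in F and not in the
      core.\<close>
    have "\<exists>v \<in># e. v \<in> N" if e: "e \<in># M2" for e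
    proof -
      obtain u v where uv: "e = {#u, v#}" "adj u v" using m12(2) e by (auto simp: matching_def)
      have "\<not> P e" using e by (simp add: M2_def)
      then have "u \<notin> core F \<or> v \<notin> core F" by (auto simp: P_def uv)
      then have "u \<in> N \<or> v \<in> N"
        using F uv(2) adj_sym[OF uv(2)] adj_in_V[OF uv(2)] adj_in_V'[OF uv(2)]
        unfolding N_def cover_def core_def by blast
      then show ?thesis by (auto simp: uv)
    qed
    then have "size M2 \<le> size (filter_mset (\<lambda>v. v \<in> N) (\<Sum>\<^sub># M2))"
      using size_matching_le_touching m12(2) by blast
    also have "\<dots> \<le> size (filter_mset (\<lambda>v. v \<in> N) (add_mset i a))"
      using M(3) M12 by (intro size_mset_mono multiset_filter_mono)
        (auto intro: subset_mset.order_trans[rotated])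
    also have "\<dots> = y" using i by (simp add: N_def y_def)
    finally have "t - y \<le> size M1" using M(2) M12 by simp
    moreover have "packs (size M1) (add_mset i a')"
    proof -
      have "\<Sum>\<^sub># M1 = filter_mset (\<lambda>v. v \<in> core F) (\<Sum>\<^sub># M1)"
        by (rule sym, subst filter_mset_eq_conv) (auto simp: M1_def P_def)
      also have "\<dots> \<subseteq># filter_mset (\<lambda>v. v \<in> core F) (add_mset i a)"
        using M(3) M12 by (intro multiset_filter_mono)
          (auto intro: subset_mset.order_trans[rotated])
      finally show ?thesis using m12(1) i by (auto simp: packs_def a'_def)
    qed
    ultimately show ?thesis using packs_antimono by blast
  qed
  show ?thesis
    using not upper by (intro exI[of _ a'] exI[of _ "t - y"]) (auto simp: a'_def)
qed

text \<open>One copy of each vertex outside F gives a partner to any vertex of F beyond the core,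
  yet creates no edge by itself: V - F is independent and has no neighbour in the core.\<close>

lemma colon_witness_core:
  assumes F: "cover F" and ne: "core F \<noteq> {}"
    and a: "set_mset a \<subseteq> core F" "\<not> packs t a"
      "\<And>i. i \<in> core F \<Longrightarrow> packs t (add_mset i a)"
  shows "colon_witness t F (a + mset_set (V - F))"
  unfolding colon_witness_def
proof (intro conjI allI impI iffI)
  have FV: "F \<subseteq> V" using F by (simp add: cover_def)
  have coreF: "core F \<subseteq> F" by (auto simp: core_def)
  show "set_mset (a + mset_set (V - F)) \<subseteq> V"
    using a(1) coreF FV finite_V by auto
  fix k assume k: "set_mset k \<subseteq> V"
  {
    assume p: "packs t (a + mset_set (V - F) + k)"
    show "set_mset k \<inter> F \<noteq> {}"
    proof
      assume kF: "set_mset k \<inter> F = {}"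
      obtain M where M: "matching M" "size M = t"
        "\<Sum>\<^sub># M \<subseteq># a + mset_set (V - F) + k"
        using p by (auto simp: packs_def)
      have in_core: "v \<in> core F" if v: "v \<in># \<Sum>\<^sub># M" for v
      proof -
        have *: "w \<in> core F \<or> w \<notin> F" if "w \<in># \<Sum>\<^sub># M" for w
          using mset_subset_eqD[OF M(3) that] a(1) kF finite_V by auto
        obtain u where u: "{#v, u#} \<in># M" "adj v u" using matching_edge_at[OF M(1) v] .
        have "u \<in># \<Sum>\<^sub># M" using u(1) by (auto intro!: bexI[of _ "{#v, u#}"])
        then show ?thesis
          using *[OF v] *[of u] F u(2) adj_sym[OF u(2)] adj_in_V[OF u(2)] adj_in_V'[OF u(2)]
          unfolding cover_def core_def by blast
      qed
      have "\<Sum>\<^sub># M \<subseteq># a"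
      proof (rule mset_subset_eqI)
        fix v
        show "count (\<Sum>\<^sub># M) v \<le> count a v"
        proof (cases "v \<in># \<Sum>\<^sub># M")
          case True
          then have "v \<in> F" using in_core coreF by blast
          then have "v \<notin># mset_set (V - F)" "v \<notin># k" using kF finite_V by auto
          then show ?thesis using mset_subset_eq_count[OF M(3), of v] by (simp add: not_in_iff)
        next
          case False
          then have "count (\<Sum>\<^sub># M) v = 0"
            by (simp only: count_eq_zero_iff not_False_eq_True)
          then show ?thesis by simp
        qed
      qed
      then show False using a(2) M by (auto simp: packs_def)
    qed
  }
  {
    assume "set_mset k \<inter> F \<noteq> {}"
    then obtain i where i: "i \<in># k" "i \<in> F" by blast
    then have ik: "{#i#} \<subseteq># k" by simp
    show "packs t (a + mset_set (V - F) + k)"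
    proof (cases "i \<in> core F")
      case True
      have "add_mset i a \<subseteq># a + mset_set (V - F) + k"
        using ik by (metis add_mset_add_single mset_subset_eq_add_left subset_mset.add_mono)
      then show ?thesis using packs_mono a(3)[OF True] by blast
    next
      case False
      then obtain o' where o: "o' \<in> V - F" "adj i o'" using i by (auto simp: core_def)
      obtain j where j: "j \<in> core F" using ne by blast
      \<comment> \<open>Adding the core vertex j and deleting it again costs at most one
        edge.\<close>
      have "packs (t - 1) a" using packs_remove1[OF a(3)[OF j], of j] by simp
      then have "packs (1 + (t - 1)) ({#i, o'#} + a)"
        using packs_edge[OF o(2)] by (intro packs_add)
      moreover have "{#i, o'#} + a \<subseteq># a + mset_set (V - F) + k"
      proof -
        have "{#o'#} \<subseteq># mset_set (V - F)" using o(1) finite_V by simp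
        then have "a + {#o'#} + {#i#} \<subseteq># a + mset_set (V - F) + k"
          using ik by (intro subset_mset.add_mono) auto
        then show ?thesis by (simp add: ac_simps)
      qed
      ultimately have "packs (1 + (t - 1)) (a + mset_set (V - F) + k)" using packs_mono by blast
      then show ?thesis using packs_antimono by simp
    qed
  }
qed

text \<open>The witness is x_i^(t-1) times the t-th power of all variables outside F. Every edge
  meets F, so t - 1 copies of i admit only t - 1 edges; a further vertex of F finds a partner
  outside F because the core is empty.\<close>

lemma colon_witness_minimal:
  assumes F: "cover F" "core F = {}" and t: "1 \<le> t"
  shows "\<exists>a. colon_witness t F a"
proof (cases "F = {}")
  case True
  then have "\<not> adj u v" for u v using F(1) by (simp add: cover_def)
  \<comment> \<open>Here \<open>1 \<le> t\<close> matters, as \<open>packs 0\<close> always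
    holds.\<close>
  then have "\<not> packs t a" for a
    using t unfolding packs_def matching_def
    by (metis multiset_nonemptyE not_one_le_zero size_empty)
  then show ?thesis using True by (auto simp: colon_witness_def intro!: exI[of _ "{#}"])
next
  case False
  have FV: "F \<subseteq> V" using F by (simp add: cover_def)
  obtain i where i: "i \<in> F" using False by blast
  have nb: "\<exists>u \<in> V - F. adj v u" if "v \<in> F" for v
    using F(2) that by (auto simp: core_def)
  obtain u where u: "u \<in> V - F" "adj i u" using nb[OF i] by blast
  define a where "a = replicate_mset (t - 1) i + repeat_mset t (mset_set (V - F))"
  have aO: "count a v = t" if "v \<in> V - F" for v
    using that i finite_V by (auto simp: a_def)
  have aF: "count a v = (if v = i then t - 1 else 0)" if "v \<in> F" for v
    using that finite_V by (auto simp: a_def)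
  have setO: "set_mset (repeat_mset t (mset_set (V - F))) \<subseteq> V - F"
  proof
    fix v assume "v \<in># repeat_mset t (mset_set (V - F))"
    then have "count (repeat_mset t (mset_set (V - F))) v \<noteq> 0"
      by (simp only: count_eq_zero_iff not_not)
    then have "count (mset_set (V - F)) v \<noteq> 0"
      by (simp only: count_repeat_mset mult_eq_0_iff de_Morgan_disj not_False_eq_True simp_thms)
    then show "v \<in> V - F" using finite_V by (metis count_mset_set(3))
  qed
  have "colon_witness t F a"
    unfolding colon_witness_def
  proof (intro conjI allI impI iffI)
    show "set_mset a \<subseteq> V" using setO i FV by (auto simp: a_def split: if_splits)
    fix k assume k: "set_mset k \<subseteq> V"
    {
      assume p: "packs t (a + k)"
      show "set_mset k \<inter> F \<noteq> {}"
      proof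
        assume kF: "set_mset k \<inter> F = {}"
        obtain M where M: "matching M" "size M = t" "\<Sum>\<^sub># M \<subseteq># a + k"
          using p by (auto simp: packs_def)
        have "\<exists>v \<in># e. v \<in> F" if e: "e \<in># M" for e
          using M(1) e F(1) unfolding matching_def cover_def by fastforce
        then have "size M \<le> size (filter_mset (\<lambda>v. v \<in> F) (\<Sum>\<^sub># M))"
          using size_matching_le_touching M(1) by blast
        also have "\<dots> \<le> size (filter_mset (\<lambda>v. v \<in> F) (a + k))"
          using M(3) by (intro size_mset_mono multiset_filter_mono)
        also have "filter_mset (\<lambda>v. v \<in> F) (a + k) = replicate_mset (t - 1) i"
        proof (rule multiset_eqI)
          fix v
          show "count (filter_mset (\<lambda>v. v \<in> F) (a + k)) v
            = count (replicate_mset (t - 1) i) v"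
            using aF[of v] kF i by (auto simp: not_in_iff[symmetric] count_eq_zero_iff)
        qed
        finally show False using M(2) t by simp
      qed
    }
    {
      assume "set_mset k \<inter> F \<noteq> {}"
      then obtain j where j: "j \<in># k" "j \<in> F" by blast
      then have jk: "{#j#} \<subseteq># k" by simp
      obtain w where w: "w \<in> V - F" "adj j w" using nb[OF j(2)] by blast
      have "packs n (replicate_mset n i + replicate_mset n u)" for n
      proof (induction n)
        case (Suc n)
        then have "packs (1 + n) ({#i, u#} + (replicate_mset n i + replicate_mset n u))"
          using packs_edge[OF u(2)] by (intro packs_add)
        then show ?case by (simp add: add_mset_commute)
      qed auto
      then have "packs (1 + (t - 1)) ({#j, w#} + (replicate_mset (t - 1) i + replicate_mset (t - 1)
        u))"
        using packs_edge[OF w(2)] by (intro packs_add)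
      moreover have "{#j, w#} + (replicate_mset (t - 1) i + replicate_mset (t - 1) u) \<subseteq># a
        + k"
      proof -
        \<comment> \<open>The partner w of j may coincide with u, hence t copies of each vertex
          outside F.\<close>
        have "{#w#} + replicate_mset (t - 1) u \<subseteq># repeat_mset t (mset_set (V - F))"
        proof (rule mset_subset_eqI)
          fix v show "count ({#w#} + replicate_mset (t - 1) u) v \<le> count (repeat_mset t
            (mset_set (V - F))) v"
            using u w finite_V t by auto
        qed
        then have "replicate_mset (t - 1) i + ({#w#} + replicate_mset (t - 1) u) + {#j#}
          \<subseteq># a + k"
          unfolding a_def using jk by (intro subset_mset.add_mono) auto
        then show ?thesis by (simp add: ac_simps add_mset_commute)
      qed
      ultimately have "packs (1 + (t - 1)) (a + k)" using packs_mono by blast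
      then show "packs t (a + k)" using packs_antimono by simp
    }
  qed
  then show ?thesis by blast
qed

end

section \<open>Monomial ideals\<close>

definition mset_of_pm :: "('v \<Rightarrow>\<^sub>0 nat) \<Rightarrow> 'v multiset" where
  "mset_of_pm m = Abs_multiset (Poly_Mapping.lookup m)"

definition pm_of_mset :: "'v multiset \<Rightarrow> 'v \<Rightarrow>\<^sub>0 nat" where
  "pm_of_mset a = Abs_poly_mapping (count a)"

lemma count_mset_of_pm [simp]: "count (mset_of_pm m) = Poly_Mapping.lookup m"
  unfolding mset_of_pm_def
  by (rule Abs_multiset_inverse) (simp add: finite_lookup)

lemma lookup_pm_of_mset [simp]: "Poly_Mapping.lookup (pm_of_mset a) = count a"
  unfolding pm_of_mset_def by (rule lookup_Abs_poly_mapping) simp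

lemma mset_of_pm_of_mset [simp]: "mset_of_pm (pm_of_mset a) = a"
  by (rule multiset_eqI) simp

lemma pm_of_mset_of_pm [simp]: "pm_of_mset (mset_of_pm m) = m"
  by (rule poly_mapping_eqI) simp

lemma mset_of_pm_add [simp]: "mset_of_pm (m + k) = mset_of_pm m + mset_of_pm k"
  by (rule multiset_eqI) (simp add: lookup_add)

lemma pm_of_mset_add [simp]: "pm_of_mset (a + b) = pm_of_mset a + pm_of_mset b"
  by (rule poly_mapping_eqI) (simp add: lookup_add)

lemma pm_of_mset_empty [simp]: "pm_of_mset {#} = 0"
  by (rule poly_mapping_eqI) simp

lemma pm_of_mset_single: "pm_of_mset {#v#} = Poly_Mapping.single v 1"
  by (rule poly_mapping_eqI) (simp add: lookup_single when_def)

lemma set_mset_of_pm [simp]: "set_mset (mset_of_pm m) = Poly_Mapping.keys m"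
  by (auto simp: in_keys_iff set_mset_def)

lemma keys_pm_of_mset [simp]: "Poly_Mapping.keys (pm_of_mset a) = set_mset a"
  by (metis mset_of_pm_of_mset set_mset_of_pm)

lemma keys_add_nat: "Poly_Mapping.keys (m + k :: 'v \<Rightarrow>\<^sub>0 nat)
  = Poly_Mapping.keys m \<union> Poly_Mapping.keys k"
  by (metis mset_of_pm_add set_mset_of_pm set_mset_union)

abbreviation monomial :: "('v \<Rightarrow>\<^sub>0 nat) \<Rightarrow> ('v \<Rightarrow>\<^sub>0
  nat) \<Rightarrow>\<^sub>0 'k::comm_ring_1" where
  "monomial m \<equiv> Poly_Mapping.single m 1"

section \<open>The polynomial ring and its monomial ideals\<close>

lemma mpoly_ring_simps [simp]:
  "carrier (mpoly_ring V) = {p. \<forall>m \<in> Poly_Mapping.keys p. Poly_Mapping.keys m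
    \<subseteq> V}"
  "p \<otimes>\<^bsub>mpoly_ring V\<^esub> q = p * q" "\<one>\<^bsub>mpoly_ring V\<^esub> = 1"
  "\<zero>\<^bsub>mpoly_ring V\<^esub> = 0" "p \<oplus>\<^bsub>mpoly_ring V\<^esub> q = p + q"
  by (simp_all add: mpoly_ring_def ring_of_type_algebra_def)

lemma lookup_single_mult:
  fixes p :: "('v \<Rightarrow>\<^sub>0 nat) \<Rightarrow>\<^sub>0 'k::field"
  shows "Poly_Mapping.lookup (monomial k * p) (k + m) = Poly_Mapping.lookup p m"
proof -
  have "Poly_Mapping.lookup (monomial k * p) (k + m) =
      (\<Sum>l. (1 when k = l) * (\<Sum>q. Poly_Mapping.lookup p q when k + m = l + q))"
    by (simp add: times_poly_mapping.rep_eq prod_fun_def lookup_single)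
  also have "\<dots> = (\<Sum>q. Poly_Mapping.lookup p q when k + m = k + q)"
    by (simp add: when_mult)
  also have "\<dots> = Poly_Mapping.lookup p m" by simp
  finally show ?thesis .
qed

text \<open>Adding k is injective on exponents, so no terms cancel and the general inclusion for
  supports of products is an equality.\<close>

lemma keys_monomial_mult:
  fixes p :: "('v \<Rightarrow>\<^sub>0 nat) \<Rightarrow>\<^sub>0 'k::field"
  shows "Poly_Mapping.keys (monomial k * p) = (+) k ` Poly_Mapping.keys p"
proof
  show "Poly_Mapping.keys (monomial k * p) \<subseteq> (+) k ` Poly_Mapping.keys p"
    using keys_mult[of "monomial k" p] by auto
  show "(+) k ` Poly_Mapping.keys p \<subseteq> Poly_Mapping.keys (monomial k * p)"
    using lookup_single_mult[of k p] by (auto simp: in_keys_iff)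
qed

lemma keys_mult_cases:
  assumes "m \<in> Poly_Mapping.keys (p * q)"
  obtains a b where "m = a + b" "a \<in> Poly_Mapping.keys p" "b \<in> Poly_Mapping.keys q"
  using assms keys_mult[of p q] by blast

lemma keys_mult_subset:
  fixes p q :: "('v \<Rightarrow>\<^sub>0 nat) \<Rightarrow>\<^sub>0 'k::field"
  assumes "\<forall>m \<in> Poly_Mapping.keys p. Poly_Mapping.keys m \<subseteq> V"
    "\<forall>m \<in> Poly_Mapping.keys q. Poly_Mapping.keys m \<subseteq> V"
  shows "\<forall>m \<in> Poly_Mapping.keys (p * q). Poly_Mapping.keys m \<subseteq> V"
proof
  fix m assume "m \<in> Poly_Mapping.keys (p * q)"
  then obtain a b where "m = a + b" "a \<in> Poly_Mapping.keys p" "b \<in> Poly_Mapping.keys q"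
    by (rule keys_mult_cases)
  then show "Poly_Mapping.keys m \<subseteq> V"
    using assms by (simp add: keys_add_nat)
qed

lemma cring_mpoly_ring: "cring (mpoly_ring V :: (('v \<Rightarrow>\<^sub>0 nat)
  \<Rightarrow>\<^sub>0 'k::field) ring)"
proof (rule cringI)
  have add: "p + q \<in> carrier (mpoly_ring V)"
    if "p \<in> carrier (mpoly_ring V)" "q \<in> carrier (mpoly_ring V)"
    for p q :: "('v \<Rightarrow>\<^sub>0 nat) \<Rightarrow>\<^sub>0 'k"
    using that keys_add[of p q] by auto
  have neg: "- p \<in> carrier (mpoly_ring V)" if "p \<in> carrier (mpoly_ring V)"
    for p :: "('v \<Rightarrow>\<^sub>0 nat) \<Rightarrow>\<^sub>0 'k"
    using that by auto
  show "abelian_group (mpoly_ring V :: (('v \<Rightarrow>\<^sub>0 nat) \<Rightarrow>\<^sub>0 'k)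
    ring)"
  proof (rule abelian_groupI)
    fix p :: "('v \<Rightarrow>\<^sub>0 nat) \<Rightarrow>\<^sub>0 'k"
    assume p: "p \<in> carrier (mpoly_ring V)"
    show "\<exists>q\<in>carrier (mpoly_ring V). q \<oplus>\<^bsub>mpoly_ring V\<^esub> p
      = \<zero>\<^bsub>mpoly_ring V\<^esub>"
      using neg[OF p] by (intro bexI[of _ "- p"]) auto
    fix q :: "('v \<Rightarrow>\<^sub>0 nat) \<Rightarrow>\<^sub>0 'k"
    assume "q \<in> carrier (mpoly_ring V)"
    with p show "p \<oplus>\<^bsub>mpoly_ring V\<^esub> q \<in> carrier (mpoly_ring V)"
      unfolding mpoly_ring_simps(5) by (rule add)
  qed (simp_all add: ac_simps)
  have mult: "p * q \<in> carrier (mpoly_ring V)"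
    if "p \<in> carrier (mpoly_ring V)" "q \<in> carrier (mpoly_ring V)"
    for p q :: "('v \<Rightarrow>\<^sub>0 nat) \<Rightarrow>\<^sub>0 'k"
    using that unfolding mpoly_ring_simps(1) mem_Collect_eq by (rule keys_mult_subset)
  show "comm_monoid (mpoly_ring V :: (('v \<Rightarrow>\<^sub>0 nat) \<Rightarrow>\<^sub>0 'k)
    ring)"
  proof (rule comm_monoidI)
    fix p q :: "('v \<Rightarrow>\<^sub>0 nat) \<Rightarrow>\<^sub>0 'k"
    assume "p \<in> carrier (mpoly_ring V)" "q \<in> carrier (mpoly_ring V)"
    then show "p \<otimes>\<^bsub>mpoly_ring V\<^esub> q \<in> carrier (mpoly_ring V)"
      unfolding mpoly_ring_simps(2) by (rule mult)
  qed (simp_all add: ac_simps)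
qed (simp add: distrib_right)

text \<open>Membership is decided term by term; the set is an ideal as soon as P is closed under
  adding exponents.\<close>

definition monomial_ideal :: "'v set \<Rightarrow> (('v \<Rightarrow>\<^sub>0 nat) \<Rightarrow>
  bool) \<Rightarrow> (('v \<Rightarrow>\<^sub>0 nat) \<Rightarrow>\<^sub>0 'k::field) set" where
  "monomial_ideal V P = {p \<in> carrier (mpoly_ring V). \<forall>m \<in> Poly_Mapping.keys p. P m}"

lemma mem_monomial_ideal:
  "p \<in> monomial_ideal V P \<longleftrightarrow> (\<forall>m
    \<in> Poly_Mapping.keys p. Poly_Mapping.keys m \<subseteq> V \<and> P m)"
  by (auto simp: monomial_ideal_def)

lemma monomial_ideal_add: "p \<in> monomial_ideal V P \<Longrightarrow> q \<in> monomial_ideal V P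
  \<Longrightarrow> p + q \<in> monomial_ideal V P"
  using keys_add[of p q] by (auto simp: mem_monomial_ideal)

lemma ideal_monomial_ideal:
  assumes "\<And>m k. P m \<Longrightarrow> P (m + k)"
  shows "ideal (monomial_ideal V P :: (('v \<Rightarrow>\<^sub>0 nat) \<Rightarrow>\<^sub>0
    'k::field) set) (mpoly_ring V)"
proof -
  interpret cring "mpoly_ring V :: (('v \<Rightarrow>\<^sub>0 nat) \<Rightarrow>\<^sub>0 'k) ring"
    by (rule cring_mpoly_ring)
  have mult: "a * x \<in> monomial_ideal V P"
    if "a \<in> monomial_ideal V P" "x \<in> carrier (mpoly_ring V)"
      for a x :: "('v \<Rightarrow>\<^sub>0 nat) \<Rightarrow>\<^sub>0 'k"
    unfolding mem_monomial_ideal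
  proof
    fix m assume "m \<in> Poly_Mapping.keys (a * x)"
    then obtain k l where "m = k + l" "k \<in> Poly_Mapping.keys a" "l \<in> Poly_Mapping.keys x"
      by (rule keys_mult_cases)
    then show "Poly_Mapping.keys m \<subseteq> V \<and> P m"
      using that assms by (auto simp: mem_monomial_ideal keys_add_nat)
  qed
  show ?thesis
  proof (rule idealI)
    show "subgroup (monomial_ideal V P) (add_monoid (mpoly_ring V :: (('v \<Rightarrow>\<^sub>0 nat)
      \<Rightarrow>\<^sub>0 'k) ring))"
    proof (rule add.subgroupI)
      show "monomial_ideal V P \<subseteq> carrier (mpoly_ring V)"
        by (auto simp: monomial_ideal_def)
      have "0 \<in> monomial_ideal V P" by (simp add: mem_monomial_ideal)
      then show "monomial_ideal V P \<noteq> {}" by blast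
      fix p q :: "('v \<Rightarrow>\<^sub>0 nat) \<Rightarrow>\<^sub>0 'k"
      assume p: "p \<in> monomial_ideal V P" "q \<in> monomial_ideal V P"
      then show "p \<oplus>\<^bsub>mpoly_ring V\<^esub> q \<in> monomial_ideal V P"
        by (simp add: monomial_ideal_add)
      have "\<ominus>\<^bsub>mpoly_ring V\<^esub> p = - p"
        by (rule minus_equality) (use p in \<open>auto simp: mem_monomial_ideal\<close>)
      then show "\<ominus>\<^bsub>mpoly_ring V\<^esub> p \<in> monomial_ideal V P"
        using p by (simp add: mem_monomial_ideal)
    qed
  qed (use mult ring_axioms in \<open>auto simp: mult.commute\<close>)
qed

section \<open>Sums of terms and leading monomials\<close>

lemma poly_mapping_sum_monomials:
  "(p :: 'a \<Rightarrow>\<^sub>0 'b::comm_monoid_add)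
    = (\<Sum>m\<in>Poly_Mapping.keys p. Poly_Mapping.single m (Poly_Mapping.lookup p m))"
proof (rule poly_mapping_eqI)
  fix m
  have "Poly_Mapping.lookup (\<Sum>m\<in>Poly_Mapping.keys p. Poly_Mapping.single m
    (Poly_Mapping.lookup p m)) m =
    (\<Sum>k\<in>Poly_Mapping.keys p. if k = m then Poly_Mapping.lookup p k else 0)"
    by (simp add: lookup_sum lookup_single when_def)
  also have "\<dots> = Poly_Mapping.lookup p m"
    by (simp add: in_keys_iff)
  finally show "Poly_Mapping.lookup p m
    = Poly_Mapping.lookup (\<Sum>m\<in>Poly_Mapping.keys p. Poly_Mapping.single m
      (Poly_Mapping.lookup p m)) m"
    by simp
qed

lemma mem_additive_of_terms:
  fixes p :: "'a \<Rightarrow>\<^sub>0 'b::comm_monoid_add"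
  assumes "0 \<in> S" "\<And>p q. p \<in> S \<Longrightarrow> q \<in> S \<Longrightarrow> p + q
    \<in> S"
    and "\<And>m. m \<in> Poly_Mapping.keys p
      \<Longrightarrow> Poly_Mapping.single m (Poly_Mapping.lookup p m) \<in> S"
  shows "p \<in> S"
proof -
  have "(\<Sum>m\<in>A. Poly_Mapping.single m (Poly_Mapping.lookup p m)) \<in> S"
    if "finite A" "A \<subseteq> Poly_Mapping.keys p" for A
    using that by induction (use assms in auto)
  then show ?thesis using poly_mapping_sum_monomials[of p] by (metis finite_keys subset_refl)
qed

lemma keys_mapp_filter [simp]:
  "Poly_Mapping.keys (Poly_Mapping.mapp (\<lambda>m c. c when m \<in> A) p)
    = Poly_Mapping.keys p \<inter> A"
  by (auto simp: in_keys_iff lookup_mapp when_def split: if_splits)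

text \<open>Once the leading terms are split off, every other contribution lies strictly below l +
  m, and the product of the leading coefficients is nonzero in a field.\<close>

lemma keys_mult_Max:
  fixes p q :: "('v::linorder \<Rightarrow>\<^sub>0 nat) \<Rightarrow>\<^sub>0 'k::field"
  assumes "p \<noteq> 0" "q \<noteq> 0"
  shows "Max (Poly_Mapping.keys p) + Max (Poly_Mapping.keys q) \<in> Poly_Mapping.keys (p * q)"
proof -
  define l m where "l = Max (Poly_Mapping.keys p)" and "m = Max (Poly_Mapping.keys q)"
  define c d where "c = Poly_Mapping.lookup p l" and "d = Poly_Mapping.lookup q m"
  have l: "l \<in> Poly_Mapping.keys p" and m: "m \<in> Poly_Mapping.keys q"
    unfolding l_def m_def using assms by (intro Max_in; simp)+
  define p' q' where "p' = p - Poly_Mapping.single l c" and "q' = q - Poly_Mapping.single m d"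
  have p': "a < l" if "a \<in> Poly_Mapping.keys p'" for a
  proof -
    have "a \<in> Poly_Mapping.keys p" "a \<noteq> l"
      using that l by (auto simp: p'_def c_def in_keys_iff lookup_minus lookup_single when_def
        split: if_splits)
    then show ?thesis using Max_ge[of "Poly_Mapping.keys p" a] by (simp add: l_def order_less_le)
  qed
  have q': "a < m" if "a \<in> Poly_Mapping.keys q'" for a
  proof -
    have "a \<in> Poly_Mapping.keys q" "a \<noteq> m"
      using that m by (auto simp: q'_def d_def in_keys_iff lookup_minus lookup_single when_def
        split: if_splits)
    then show ?thesis using Max_ge[of "Poly_Mapping.keys q" a] by (simp add: m_def order_less_le)
  qed
  have "p * q = Poly_Mapping.single (l + m) (c * d) + (Poly_Mapping.single l c * q' + p' * q)"
    by (simp add: p'_def q'_def algebra_simps mult_single)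
  moreover have "l + m \<notin> Poly_Mapping.keys (Poly_Mapping.single l c * q')"
  proof
    assume "l + m \<in> Poly_Mapping.keys (Poly_Mapping.single l c * q')"
    then obtain a b where ab: "l + m = a + b" "a \<in> Poly_Mapping.keys (Poly_Mapping.single l c)"
        "b \<in> Poly_Mapping.keys q'"
      using keys_mult[of "Poly_Mapping.single l c" q'] by blast
    then have "m = b" by (simp split: if_splits)
    then show False using q' ab(3) by blast
  qed
  moreover have "l + m \<notin> Poly_Mapping.keys (p' * q)"
  proof
    assume "l + m \<in> Poly_Mapping.keys (p' * q)"
    then obtain a b where ab: "l + m = a + b" "a \<in> Poly_Mapping.keys p'"
      "b \<in> Poly_Mapping.keys q"
      using keys_mult[of p' q] by blast
    have "a + b < l + m"
      using p'[OF ab(2)] Max_ge[of "Poly_Mapping.keys q" b] ab(3)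
        by (intro add_less_le_mono) (auto simp: m_def)
    then show False using ab(1) by simp
  qed
  ultimately have "Poly_Mapping.lookup (p * q) (l + m) = c * d"
    by (simp add: lookup_add in_keys_iff)
  then show ?thesis using l m by (simp add: in_keys_iff c_def d_def l_def m_def)
qed

section \<open>Associated primes of monomial ideals\<close>

text \<open>The prime generated by the variables x_i with i in F, written P_F above.\<close>

definition face_prime :: "'v set \<Rightarrow> 'v set \<Rightarrow> (('v \<Rightarrow>\<^sub>0 nat)
  \<Rightarrow>\<^sub>0 'k::field) set" where
  "face_prime V F = monomial_ideal V (\<lambda>m. Poly_Mapping.keys m \<inter> F \<noteq> {})"

lemma monomial_in_carrier: "Poly_Mapping.keys m \<subseteq> V
  \<Longrightarrow> Poly_Mapping.single m c \<in> carrier (mpoly_ring V)"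
  by simp

lemma carrier_keys: "p \<in> carrier (mpoly_ring V) \<Longrightarrow> m \<in> Poly_Mapping.keys p
  \<Longrightarrow> Poly_Mapping.keys m \<subseteq> V"
  by simp

lemma primeideal_mpolyD:
  assumes "primeideal P (mpoly_ring V :: (('v \<Rightarrow>\<^sub>0 nat) \<Rightarrow>\<^sub>0
    'k::field) ring)"
  shows "p \<in> P \<Longrightarrow> p \<in> carrier (mpoly_ring V)" "0 \<in> P"
    "p \<in> P \<Longrightarrow> q \<in> P \<Longrightarrow> p + q \<in> P"
    "p \<in> P \<Longrightarrow> q \<in> carrier (mpoly_ring V) \<Longrightarrow> q * p \<in> P"
    "1 \<notin> P"
    "p \<in> carrier (mpoly_ring V) \<Longrightarrow> q \<in> carrier (mpoly_ring V)
      \<Longrightarrow> p * q \<in> P \<Longrightarrow> p \<in> P \<or> q \<in> P"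
proof -
  have J: "ideal P (mpoly_ring V)" using assms by (rule primeideal.axioms(1))
  show "p \<in> P \<Longrightarrow> p \<in> carrier (mpoly_ring V)" by (rule ideal.Icarr[OF J])
  show "0 \<in> P"
    using additive_subgroup.zero_closed[OF ideal.axioms(1)[OF J]] by (simp only: mpoly_ring_simps)
  show "p + q \<in> P" if "p \<in> P" "q \<in> P"
    using additive_subgroup.a_closed[OF ideal.axioms(1)[OF J] that] by (simp only: mpoly_ring_simps)
  show "q * p \<in> P" if "p \<in> P" "q \<in> carrier (mpoly_ring V)"
    using ideal.I_l_closed[OF J that] by (simp only: mpoly_ring_simps)
  show "1 \<notin> P"
    using ideal.one_imp_carrier[OF J] primeideal.I_notcarr[OF assms] by (metis mpoly_ring_simps(3))
  show "p \<in> P \<or> q \<in> P" if "p \<in> carrier (mpoly_ring V)"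
    "q \<in> carrier (mpoly_ring V)" "p * q \<in> P"
    using primeideal.I_prime[OF assms that(1,2)] that(3) by (simp only: mpoly_ring_simps)
qed

text \<open>
  Among the \<open>r\<close> with \<open>P = J : r\<close> take one with the fewest terms outside \<open>J\<close>.  If the leading
  monomial of some \<open>p \<in> P\<close> were not in \<open>P\<close>, multiplying \<open>r\<close> by it would preserve \<open>P = J : r\<close>,
  since \<open>P\<close> is prime, but push the leading term of the part of \<open>r\<close> outside \<open>J\<close> into \<open>J\<close>.
\<close>
lemma colon_prime_leading_monomial:
  fixes P :: "(('v::linorder \<Rightarrow>\<^sub>0 nat) \<Rightarrow>\<^sub>0 'k::field) set"
  assumes mono: "\<And>m k. Q m \<Longrightarrow> Q (m + k)"
    and P: "primeideal P (mpoly_ring V)"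
    and r: "r \<in> carrier (mpoly_ring V)"
      "P = {q \<in> carrier (mpoly_ring V). q * r \<in> monomial_ideal V Q}"
    and p: "p \<in> P" "p \<noteq> 0"
  shows "monomial (Max (Poly_Mapping.keys p)) \<in> P"
proof (rule ccontr)
  define l where "l = Max (Poly_Mapping.keys p)"
  assume "monomial (Max (Poly_Mapping.keys p)) \<notin> P"
  then have not: "monomial l \<notin> P" by (simp add: l_def)
  note PD = primeideal_mpolyD[OF P]
  define good where "good r \<longleftrightarrow> r \<in> carrier (mpoly_ring V) \<and> P = {q
    \<in> carrier (mpoly_ring V). q * r \<in> monomial_ideal V Q}" for r
  define N where "N r = {m \<in> Poly_Mapping.keys r. \<not> Q m}"
    for r :: "('v \<Rightarrow>\<^sub>0 nat) \<Rightarrow>\<^sub>0 'k"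
  obtain s where s: "good s" "\<And>s'. good s' \<Longrightarrow> card (N s) \<le> card (N s')"
    using ex_has_least_nat[of good r "\<lambda>r. card (N r)"] r by (auto simp: good_def)
  have s_carr: "s \<in> carrier (mpoly_ring V)"
    and colon: "\<And>q. q \<in> P \<longleftrightarrow> q \<in> carrier (mpoly_ring V) \<and> q * s
      \<in> monomial_ideal V Q"
    using s(1) by (auto simp: good_def)
  have "l \<in> Poly_Mapping.keys p" unfolding l_def using p(2) by (intro Max_in) auto
  then have lV: "Poly_Mapping.keys l \<subseteq> V" using carrier_keys[OF PD(1)[OF p(1)]] by blast
  then have l_carr: "monomial l \<in> carrier (mpoly_ring V)" by (rule monomial_in_carrier)
  have ls_carr: "monomial l * s \<in> carrier (mpoly_ring V)"
    using keys_mult_subset[of "monomial l" V s] lV s_carr by auto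
  \<comment> \<open>As P is prime and x^l is not in P, multiplying s by x^l leaves the colon ideal
    unchanged.\<close>
  have "q \<in> P \<longleftrightarrow> q \<in> carrier (mpoly_ring V) \<and> q * (monomial l * s)
    \<in> monomial_ideal V Q" for q
  proof (cases "q \<in> carrier (mpoly_ring V)")
    case True
    have "q * (monomial l * s) \<in> monomial_ideal V Q \<longleftrightarrow> q * monomial l
      \<in> P"
      using colon[of "q * monomial l"] keys_mult_subset[of q V "monomial l"] True lV
        by (simp add: mult.assoc)
    also have "\<dots> \<longleftrightarrow> q \<in> P"
      using PD(4)[of q "monomial l"] PD(6)[OF True l_carr] not l_carr by (auto simp: mult.commute)
    finally show ?thesis using True by simp
  qed (use PD(1) in blast)
  then have "good (monomial l * s)" using ls_carr unfolding good_def by blast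
  then have card: "card (N s) \<le> card (N (monomial l * s))" by (rule s(2))
  \<comment> \<open>s0 collects the terms of s outside the monomial ideal J, s1 those in J.\<close>
  define s0 s1 where "s0 = Poly_Mapping.mapp (\<lambda>m c. c when m \<in> N s) s" and "s1 = s - s0"
  have "Poly_Mapping.keys s0 = Poly_Mapping.keys s \<inter> N s" unfolding s0_def
    by (rule keys_mapp_filter)
  then have keys_s0: "Poly_Mapping.keys s0 = N s" by (auto simp: N_def)
  have keys_s1: "Q m" if "m \<in> Poly_Mapping.keys s1" for m
    using that by (auto simp: s1_def s0_def N_def in_keys_iff lookup_minus lookup_mapp when_def
      split: if_splits)
  have "s \<notin> monomial_ideal V Q"
    using colon[of 1] PD(5) by auto
  then have "N s \<noteq> {}" using s_carr by (auto simp: mem_monomial_ideal N_def)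
  then have "s0 \<noteq> 0" using keys_s0 by auto
  define \<mu> where "\<mu> = Max (N s)"
  have fin: "finite (N s)" using keys_s0 by (metis finite_keys)
  have \<mu>: "\<mu> \<in> N s" unfolding \<mu>_def using fin \<open>N s \<noteq> {}\<close>
    by (rule Max_in)
  have lead: "l + \<mu> \<in> Poly_Mapping.keys (p * s0)"
    using keys_mult_Max[OF p(2) \<open>s0 \<noteq> 0\<close>] by (simp add: l_def \<mu>_def keys_s0)
  \<comment> \<open>The leading term of p * s0 occurs in p * s, which lies in J, or in p * s1, all
    of whose terms lie in J.\<close>
  have "Q (l + \<mu>)"
  proof (cases "l + \<mu> \<in> Poly_Mapping.keys (p * s)")
    case True
    have "p * s \<in> monomial_ideal V Q" using colon p(1) by blast
    then show ?thesis using True by (simp add: mem_monomial_ideal)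
  next
    case False
    have "p * s0 = p * s - p * s1" by (simp add: s1_def algebra_simps)
    then have "l + \<mu> \<in> Poly_Mapping.keys (p * s1)"
      using lead False keys_diff[of "p * s" "p * s1"] by auto
    then obtain a b where "l + \<mu> = a + b" "b \<in> Poly_Mapping.keys s1"
      by (rule keys_mult_cases)
    then show ?thesis using keys_s1 mono[of b a] by (simp add: add.commute)
  qed
  \<comment> \<open>Terms in J stay in J under the shift by l, and \<mu> has moved into J: fewer
    terms are left outside, against the choice of s.\<close>
  then have "N (monomial l * s) \<subseteq> (+) l ` (N s - {\<mu>})"
    using mono unfolding N_def keys_monomial_mult by (auto simp: add.commute)
  then have "card (N (monomial l * s)) \<le> card (N s - {\<mu>})"
    using fin by (meson card_image_le card_mono finite_Diff finite_imageI le_trans)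
  also have "\<dots> < card (N s)" using fin \<mu> by (rule card_Diff1_less)
  finally show False using card by simp
qed

text \<open>The leading term of p can be subtracted without leaving P, which lowers the number of
  terms. Thus P is itself a monomial ideal.\<close>

lemma colon_prime_monomial:
  fixes P :: "(('v::linorder \<Rightarrow>\<^sub>0 nat) \<Rightarrow>\<^sub>0 'k::field) set"
  assumes mono: "\<And>m k. Q m \<Longrightarrow> Q (m + k)"
    and P: "primeideal P (mpoly_ring V)"
    and r: "r \<in> carrier (mpoly_ring V)"
      "P = {q \<in> carrier (mpoly_ring V). q * r \<in> monomial_ideal V Q}"
    and p: "p \<in> P" "m \<in> Poly_Mapping.keys p"
  shows "monomial m \<in> P"
  using p
proof (induction "card (Poly_Mapping.keys p)" arbitrary: p rule: less_induct)
  case less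
  note PD = primeideal_mpolyD[OF P]
  define l c where "l = Max (Poly_Mapping.keys p)" and "c = - Poly_Mapping.lookup p l"
  have "p \<noteq> 0" using less.prems(2) by auto
  have l: "monomial l \<in> P"
    unfolding l_def by (rule colon_prime_leading_monomial[OF mono P r less.prems(1) \<open>p
      \<noteq> 0\<close>])
  have lp: "l \<in> Poly_Mapping.keys p" unfolding l_def using \<open>p \<noteq> 0\<close>
    by (intro Max_in) auto
  have "Poly_Mapping.single l c = Poly_Mapping.single 0 c * monomial l"
    by (simp add: mult_single)
  also have "\<dots> \<in> P" by (rule PD(4)[OF l]) simp
  finally have in_P: "p + Poly_Mapping.single l c \<in> P" using PD(3) less.prems(1) by blast
  have keys: "Poly_Mapping.keys (p + Poly_Mapping.single l c) = Poly_Mapping.keys p - {l}"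
    by (auto simp: in_keys_iff lookup_add lookup_single when_def c_def split: if_splits)
  show ?case
  proof (cases "m = l")
    case False
    have "card (Poly_Mapping.keys p - {l}) < card (Poly_Mapping.keys p)"
      using lp by (intro card_Diff1_less) auto
    then show ?thesis using less.hyps[OF _ in_P] keys False less.prems(2) by simp
  qed (use l in simp)
qed

lemma prime_monomial_product:
  assumes P: "primeideal P (mpoly_ring V :: (('v \<Rightarrow>\<^sub>0 nat) \<Rightarrow>\<^sub>0
    'k::field) ring)"
    and "finite A" "\<And>x. x \<in> A \<Longrightarrow> Poly_Mapping.keys (f x) \<subseteq> V"
      "monomial (\<Sum>x\<in>A. f x) \<in> P"
  shows "\<exists>x\<in>A. monomial (f x) \<in> P"
  using assms(2-)
proof (induction A)
  case empty
  then show ?case using primeideal_mpolyD(5)[OF P] by simp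
next
  case (insert x A)
  have keys: "Poly_Mapping.keys (\<Sum>x\<in>A. f x) \<subseteq> V"
    using keys_sum[of f A] insert.prems(1) by blast
  have "(monomial (\<Sum>x\<in>insert x A. f x) :: ('v \<Rightarrow>\<^sub>0 nat)
    \<Rightarrow>\<^sub>0 'k) = monomial (f x) * monomial (\<Sum>x\<in>A. f x)"
    using insert.hyps by (simp add: mult_single)
  then have "monomial (f x) \<in> P \<or> monomial (\<Sum>x\<in>A. f x) \<in> P"
    using primeideal_mpolyD(6)[OF P monomial_in_carrier[of "f x" V 1] monomial_in_carrier[OF keys,
      of 1]]
      insert.prems by simp
  then show ?case using insert by blast
qed

text \<open>Being prime and monomial, P is generated by the variables it contains. Primality is used
  again to replace r by one of its own terms.\<close>

lemma colon_prime_is_face_prime: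
  fixes P :: "(('v::linorder \<Rightarrow>\<^sub>0 nat) \<Rightarrow>\<^sub>0 'k::field) set"
  assumes mono: "\<And>m k. Q m \<Longrightarrow> Q (m + k)"
    and P: "primeideal P (mpoly_ring V)"
    and r: "r \<in> carrier (mpoly_ring V)"
      "P = {q \<in> carrier (mpoly_ring V). q * r \<in> monomial_ideal V Q}"
  shows "\<exists>F \<subseteq> V. P = face_prime V F \<and>
    (\<exists>m. Poly_Mapping.keys m \<subseteq> V \<and> (\<forall>k. Poly_Mapping.keys k
      \<subseteq> V \<longrightarrow> (Q (m + k) \<longleftrightarrow> Poly_Mapping.keys k \<inter>
        F \<noteq> {})))"
proof -
  note PD = primeideal_mpolyD[OF P]
  define F where "F = {i \<in> V. monomial (Poly_Mapping.single i 1) \<in> P}"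
  have mon: "monomial (pm_of_mset a) \<in> P
    \<longleftrightarrow> set_mset a \<inter> F \<noteq> {}" if "set_mset a \<subseteq> V" for a
    using that
  proof (induction a)
    case empty
    then show ?case using PD(5) by simp
  next
    case (add i a)
    have eq: "(monomial (pm_of_mset (add_mset i a)) :: ('v \<Rightarrow>\<^sub>0 nat)
      \<Rightarrow>\<^sub>0 'k) =
        monomial (Poly_Mapping.single i 1) * monomial (pm_of_mset a)"
      using pm_of_mset_add[of "{#i#}" a] by (simp add: mult_single pm_of_mset_single)
    have carr: "monomial (Poly_Mapping.single i 1) \<in> carrier (mpoly_ring V)"
      "monomial (pm_of_mset a) \<in> carrier (mpoly_ring V)"
      using add.prems by auto
    have "monomial (pm_of_mset (add_mset i a)) \<in> P \<longleftrightarrow>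
        monomial (Poly_Mapping.single i 1) \<in> P \<or> monomial (pm_of_mset a) \<in> P"
      unfolding eq using PD(6)[OF carr] PD(4)[OF _ carr(1), of "monomial (pm_of_mset a)"]
        PD(4)[OF _ carr(2), of "monomial (Poly_Mapping.single i 1)"] by (metis mult.commute)
    then show ?case using add by (auto simp: F_def)
  qed
  have monP: "monomial k \<in> P \<longleftrightarrow> Poly_Mapping.keys k \<inter> F \<noteq> {}"
    if "Poly_Mapping.keys k \<subseteq> V" for k
    using mon[of "mset_of_pm k"] that by simp
  have "p \<in> P \<longleftrightarrow> p \<in> face_prime V F" for p
  proof
    assume p: "p \<in> P"
    show "p \<in> face_prime V F"
      unfolding face_prime_def mem_monomial_ideal
      using colon_prime_monomial[OF mono P r p] monP carrier_keys[OF PD(1)[OF p]] by blast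
  next
    assume p: "p \<in> face_prime V F"
    show "p \<in> P"
    proof (rule mem_additive_of_terms)
      fix m assume m: "m \<in> Poly_Mapping.keys p"
      have "monomial m \<in> P" using p m monP unfolding face_prime_def mem_monomial_ideal by blast
      then have "Poly_Mapping.single 0 (Poly_Mapping.lookup p m) * monomial m \<in> P"
        by (rule PD(4)) simp
      then show "Poly_Mapping.single m (Poly_Mapping.lookup p m) \<in> P" by (simp add: mult_single)
    qed (use PD in auto)
  qed
  then have PF: "P = face_prime V F" by blast
  \<comment> \<open>If every term of r were carried into J by some monomial outside P, the product
    of these monomials would carry r into J and so lie in P, against primality.\<close>
  have "\<exists>m \<in> Poly_Mapping.keys r. \<forall>k. Poly_Mapping.keys k \<subseteq> V
    \<longrightarrow> Q (m + k) \<longrightarrow> monomial k \<in> P"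
  proof (rule ccontr)
    assume "\<not> ?thesis"
    then obtain k where k: "\<And>m. m \<in> Poly_Mapping.keys r
      \<Longrightarrow> Poly_Mapping.keys (k m) \<subseteq> V \<and> Q (m + k m) \<and> monomial
        (k m) \<notin> P"
      by metis
    define K where "K = (\<Sum>m\<in>Poly_Mapping.keys r. k m)"
    have KV: "Poly_Mapping.keys K \<subseteq> V" using keys_sum[of k "Poly_Mapping.keys r"] k
      unfolding K_def by blast
    have "Q (m + K)" if "m \<in> Poly_Mapping.keys r" for m
    proof -
      have "K = k m + (\<Sum>m\<in>Poly_Mapping.keys r - {m}. k m)"
        using that by (simp add: K_def sum.remove)
      then show ?thesis using k[OF that] mono by (metis add.assoc)
    qed
    then have "monomial K * r \<in> monomial_ideal V Q"
      unfolding mem_monomial_ideal keys_monomial_mult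
      using KV carrier_keys[OF r(1)] by (auto simp: keys_add_nat add.commute)
    then have "monomial K \<in> P" using r KV by simp
    then show False using prime_monomial_product[OF P, of "Poly_Mapping.keys r" k] k unfolding K_def
      by auto
  qed
  then obtain m where m: "m \<in> Poly_Mapping.keys r"
    and m_P: "\<And>k. Poly_Mapping.keys k \<subseteq> V \<Longrightarrow> Q (m + k)
      \<Longrightarrow> monomial k \<in> P"
    by blast
  have P_m: "Q (m + k)" if "monomial k \<in> P" for k
  proof -
    have "monomial k * r \<in> monomial_ideal V Q" using that r by blast
    then show ?thesis using m by (auto simp: mem_monomial_ideal keys_monomial_mult add.commute)
  qed
  show ?thesis
  proof (intro exI conjI allI impI)
    show "F \<subseteq> V" by (auto simp: F_def)
    show "P = face_prime V F" by (rule PF)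
    show "Poly_Mapping.keys m \<subseteq> V" using carrier_keys[OF r(1) m] .
    fix k :: "'v \<Rightarrow>\<^sub>0 nat" assume k: "Poly_Mapping.keys k \<subseteq> V"
    show "Q (m + k) \<longleftrightarrow> Poly_Mapping.keys k \<inter> F \<noteq> {}"
      using m_P[OF k] P_m[of k] monP[OF k] by blast
  qed
qed

text \<open>Modulo P_F only the terms free of F matter. The F-free parts p0 and q0 have a nonzero
  product with F-free terms, which the other products cannot cancel.\<close>

lemma primeideal_face_prime:
  "primeideal (face_prime V F :: (('v::linorder \<Rightarrow>\<^sub>0 nat) \<Rightarrow>\<^sub>0
    'k::field) set) (mpoly_ring V)"
proof (rule primeidealI)
  show "ideal (face_prime V F :: (('v \<Rightarrow>\<^sub>0 nat) \<Rightarrow>\<^sub>0 'k) set)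
    (mpoly_ring V)"
    unfolding face_prime_def by (rule ideal_monomial_ideal) (auto simp: keys_add_nat)
  show "cring (mpoly_ring V :: (('v \<Rightarrow>\<^sub>0 nat) \<Rightarrow>\<^sub>0 'k) ring)"
    by (rule cring_mpoly_ring)
  have "(1 :: ('v \<Rightarrow>\<^sub>0 nat) \<Rightarrow>\<^sub>0 'k) \<notin> face_prime V F"
    by (simp add: face_prime_def mem_monomial_ideal)
  moreover have "(1 :: ('v \<Rightarrow>\<^sub>0 nat) \<Rightarrow>\<^sub>0 'k)
    \<in> carrier (mpoly_ring V)" by simp
  ultimately show "carrier (mpoly_ring V) \<noteq> (face_prime V F :: (('v \<Rightarrow>\<^sub>0
    nat) \<Rightarrow>\<^sub>0 'k) set)" by blast
  fix p q :: "('v \<Rightarrow>\<^sub>0 nat) \<Rightarrow>\<^sub>0 'k"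
  assume p: "p \<in> carrier (mpoly_ring V)" and q: "q \<in> carrier (mpoly_ring V)"
    and pq: "p \<otimes>\<^bsub>mpoly_ring V\<^esub> q \<in> face_prime V F"
  define A where "A = {m :: 'v \<Rightarrow>\<^sub>0 nat. Poly_Mapping.keys m \<inter> F = {}}"
  define p0 q0 where "p0 = Poly_Mapping.mapp (\<lambda>m c. c when m \<in> A) p"
    and "q0 = Poly_Mapping.mapp (\<lambda>m c. c when m \<in> A) q"
  define p1 q1 where "p1 = p - p0" and "q1 = q - q0"
  have keys0: "Poly_Mapping.keys p0 = Poly_Mapping.keys p \<inter> A"
    "Poly_Mapping.keys q0 = Poly_Mapping.keys q \<inter> A"
    by (auto simp: p0_def q0_def)
  have keys1: "Poly_Mapping.keys p1 \<inter> A = {}" "Poly_Mapping.keys q1 \<inter> A = {}"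
    by (auto simp: p1_def q1_def p0_def q0_def in_keys_iff lookup_minus lookup_mapp when_def split:
      if_splits)
  have A_add: "a + b \<in> A \<longleftrightarrow> a \<in> A \<and> b \<in> A" for a b
    by (auto simp: A_def keys_add_nat)
  show "p \<in> face_prime V F \<or> q \<in> face_prime V F"
  proof (rule ccontr)
    assume "\<not> ?thesis"
    then have "Poly_Mapping.keys p0 \<noteq> {}" "Poly_Mapping.keys q0 \<noteq> {}"
      using p q unfolding keys0 by (auto simp: face_prime_def mem_monomial_ideal A_def)
    then have "p0 * q0 \<noteq> 0" by auto
    then obtain m where m: "m \<in> Poly_Mapping.keys (p0 * q0)" by (metis ex_in_conv keys_eq_empty)
    then have mA: "m \<in> A" using keys0 by (auto elim!: keys_mult_cases simp: A_add)
    have "p0 * q0 = p * q - (p1 * q + p0 * q1)"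
      by (simp add: p1_def q1_def algebra_simps)
    then have "m \<in> Poly_Mapping.keys (p * q) \<or> m \<in> Poly_Mapping.keys (p1 * q) \<or> m
      \<in> Poly_Mapping.keys (p0 * q1)"
      using m keys_diff[of "p * q" "p1 * q + p0 * q1"] keys_add[of "p1 * q" "p0 * q1"] by auto
    moreover have "m \<notin> Poly_Mapping.keys (p * q)"
      using pq mA by (auto simp: face_prime_def mem_monomial_ideal A_def)
    moreover have "m \<notin> Poly_Mapping.keys (p1 * q)"
      using keys1 mA by (auto elim!: keys_mult_cases simp: A_add)
    moreover have "m \<notin> Poly_Mapping.keys (p0 * q1)"
      using keys1 mA by (auto elim!: keys_mult_cases simp: A_add)
    ultimately show False by blast
  qed
qed

lemma colon_primes_monomial_ideal:
  fixes V :: "'v::linorder set"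
  assumes mono: "\<And>m k. Q m \<Longrightarrow> Q (m + k)"
  shows "{P :: (('v \<Rightarrow>\<^sub>0 nat) \<Rightarrow>\<^sub>0 'k::field) set. primeideal P
    (mpoly_ring V) \<and>
      (\<exists>r \<in> carrier (mpoly_ring V). P = {q \<in> carrier (mpoly_ring V). q * r \<in>
        monomial_ideal V Q})} =
    face_prime V ` {F. F \<subseteq> V \<and> (\<exists>m. Poly_Mapping.keys m \<subseteq> V \<and>
      (\<forall>k. Poly_Mapping.keys k \<subseteq> V \<longrightarrow> (Q (m + k)
        \<longleftrightarrow> Poly_Mapping.keys k \<inter> F \<noteq> {})))}"
    (is "?L = ?R")
proof
  show "?L \<subseteq> ?R"
  proof
    fix P :: "(('v \<Rightarrow>\<^sub>0 nat) \<Rightarrow>\<^sub>0 'k) set" assume "P \<in> ?L"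
    then obtain r where P: "primeideal P (mpoly_ring V)" and r: "r \<in> carrier (mpoly_ring V)"
      "P = {q \<in> carrier (mpoly_ring V). q * r \<in> monomial_ideal V Q}" by blast
    show "P \<in> ?R"
      using colon_prime_is_face_prime[of Q P V r, OF mono P r] by blast
  qed
  show "?R \<subseteq> ?L"
  proof
    fix P :: "(('v \<Rightarrow>\<^sub>0 nat) \<Rightarrow>\<^sub>0 'k) set" assume "P \<in> ?R"
    then obtain F m where F: "P = face_prime V F" and m: "Poly_Mapping.keys m \<subseteq> V"
      "\<And>k. Poly_Mapping.keys k \<subseteq> V \<Longrightarrow> Q (m + k)
        \<longleftrightarrow> Poly_Mapping.keys k \<inter> F \<noteq> {}"
      by blast
    have "q \<in> P \<longleftrightarrow> q \<in> carrier (mpoly_ring V) \<and> q * monomial m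
      \<in> monomial_ideal V Q" for q
    proof -
      have "q * monomial m = monomial m * q" by (rule mult.commute)
      show ?thesis
        unfolding F face_prime_def mem_monomial_ideal \<open>q * monomial m = monomial m * q\<close>
          keys_monomial_mult
        using m by (auto simp: keys_add_nat)
    qed
    then have "P = {q \<in> carrier (mpoly_ring V). q * monomial m \<in> monomial_ideal V Q}"
      by blast
    moreover have "monomial m \<in> carrier (mpoly_ring V)" using m(1) by (rule monomial_in_carrier)
    moreover have "primeideal P (mpoly_ring V)" unfolding F by (rule primeideal_face_prime)
    ultimately show "P \<in> ?L" unfolding mem_Collect_eq by (intro conjI bexI)
  qed
qed

text \<open>F is recovered as the set of variables in its prime; this lets sets of primes be
  compared through sets of covers.\<close>

lemma inj_on_face_prime: "inj_on (face_prime V :: _ \<Rightarrow> (('v \<Rightarrow>\<^sub>0 nat)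
  \<Rightarrow>\<^sub>0 'k::field) set) (Pow V)"
proof (rule inj_on_inverseI)
  fix F assume "F \<in> Pow V"
  then show "{i \<in> V. (monomial (Poly_Mapping.single i 1) :: ('v \<Rightarrow>\<^sub>0 nat)
    \<Rightarrow>\<^sub>0 'k) \<in> face_prime V F} = F"
    by (auto simp: face_prime_def mem_monomial_ideal)
qed

text \<open>The annihilator of the coset of r is J : r, so the quotient module disappears from the
  argument.\<close>

lemma associated_primes_quot_module:
  fixes R (structure)
  assumes "cring R" "ideal J R"
  shows "associated_primes R (quot_module R J) =
    {P. primeideal P R \<and> (\<exists>r \<in> carrier R. P = {q \<in> carrier R. q
      \<otimes>\<^bsub>R\<^esub> r \<in> J})}"
proof -
  interpret cring R by fact
  interpret J: ideal J R by fact
  have carr: "carrier (quot_module R J) = (\<lambda>r. J +> r) ` carrier R"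
    by (auto simp: quot_module_def ring.defs module.defs FactRing_def A_RCOSETS_def')
  have smult: "q \<odot>\<^bsub>quot_module R J\<^esub> (J +> r)
    = \<zero>\<^bsub>quot_module R J\<^esub> \<longleftrightarrow> q \<otimes> r \<in> J"
    if "q \<in> carrier R" "r \<in> carrier R" for q r
  proof -
    have "q \<odot>\<^bsub>quot_module R J\<^esub> (J +> r) = J +> (q \<otimes> r)"
      "\<zero>\<^bsub>quot_module R J\<^esub> = J"
      using J.rcoset_mult_add[OF that] by
        (simp_all add: quot_module_def ring.defs module.defs FactRing_def)
    moreover have "q \<otimes> r \<in> carrier R" using that by simp
    ultimately show ?thesis
      using J.rcos_const_imp_mem[of "q \<otimes> r"] a_rcos_zero[OF assms(2), of "q \<otimes> r"]
        by auto
  qed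
  show ?thesis
    unfolding associated_primes_def carr bex_simps(7) using smult by (simp cong: conj_cong)
qed

section \<open>Powers of the edge ideal as monomial ideals\<close>

context adjacency begin

lemma packs_mset_of_pm_Suc:
  assumes "packs (Suc t) (mset_of_pm m)"
  obtains u v k where "adj u v" "packs t (mset_of_pm k)"
    "m = Poly_Mapping.single u 1 + Poly_Mapping.single v 1 + k"
proof -
  obtain M where M: "matching M" "size M = Suc t" "\<Sum>\<^sub># M \<subseteq># mset_of_pm m"
    using assms by (auto simp: packs_def)
  obtain e M' where M': "M = add_mset e M'" using M(2) by (cases M) auto
  then obtain u v where uv: "e = {#u, v#}" "adj u v" using M(1) by auto
  obtain a where a: "mset_of_pm m = \<Sum>\<^sub># M + a" using M(3)
    by (auto simp: mset_subset_eq_exists_conv)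
  have "m = pm_of_mset ({#u#} + {#v#} + (\<Sum>\<^sub># M' + a))"
    using arg_cong[OF a, of pm_of_mset] by (simp add: M' uv add_mset_commute)
  then have "m = Poly_Mapping.single u 1 + Poly_Mapping.single v 1 + pm_of_mset (\<Sum>\<^sub># M' +
    a)"
    by (simp only: pm_of_mset_add pm_of_mset_single)
  moreover have "packs t (mset_of_pm (pm_of_mset (\<Sum>\<^sub># M' + a)))"
    using M M' by (auto simp: packs_def)
  ultimately show thesis using that uv(2) by blast
qed

text \<open>Each term of the larger power splits off one edge as a generator of I, its coefficient
  staying with the remaining factor. At t = 0 both sides are the whole ring.\<close>

lemma edge_ideal_power:
  fixes R :: "(('v \<Rightarrow>\<^sub>0 nat) \<Rightarrow>\<^sub>0 'k::field) ring"
  assumes R: "R = mpoly_ring V" and V: "\<And>u v. adj u v \<Longrightarrow> u \<in> V \<and> v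
    \<in> V"
    and I: "I = Idl\<^bsub>R\<^esub> {mpoly_var i * mpoly_var j | i j. adj i j}"
  shows "I [^]\<^bsub>ideals_set R\<^esub> t
    = monomial_ideal V (\<lambda>m. packs t (mset_of_pm m))"
proof -
  interpret cring R unfolding R by (rule cring_mpoly_ring)
  let ?M = "\<lambda>t. monomial_ideal V (\<lambda>m. packs t (mset_of_pm m)) :: (('v
    \<Rightarrow>\<^sub>0 nat) \<Rightarrow>\<^sub>0 'k) set"
  let ?G = "{mpoly_var i * mpoly_var j | i j. adj i j} :: (('v \<Rightarrow>\<^sub>0 nat)
    \<Rightarrow>\<^sub>0 'k) set"
  have idM: "ideal (?M t) R" for t
    unfolding R by (rule ideal_monomial_ideal) (auto intro: packs_mono)
  have var: "mpoly_var i * mpoly_var j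
    = (monomial (Poly_Mapping.single i 1 + Poly_Mapping.single j 1) :: ('v \<Rightarrow>\<^sub>0
      nat) \<Rightarrow>\<^sub>0 'k)" for i j
    by (simp add: mpoly_var_def mult_single)
  have G: "?G \<subseteq> ?M 1"
  proof
    fix p assume "p \<in> ?G"
    then obtain i j where ij: "p = mpoly_var i * mpoly_var j" "adj i j" by blast
    have "mset_of_pm (Poly_Mapping.single i 1 + Poly_Mapping.single j 1) = {#i, j#}"
      by (metis mset_of_pm_of_mset mset_of_pm_add pm_of_mset_single add_mset_add_single
        add_mset_commute)
    then show "p \<in> ?M 1"
      using V[OF ij(2)] packs_edge[OF ij(2)] unfolding ij(1) var
      by (simp add: mem_monomial_ideal keys_add_nat)
  qed
  have carrM: "?M t \<subseteq> carrier R" for t using ideal.Icarr[OF idM] by blast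
  have Gcarr: "?G \<subseteq> carrier R" using G carrM by blast
  have idI: "ideal I R" unfolding I by (rule genideal_ideal[OF Gcarr])
  have IM: "I \<subseteq> ?M 1" unfolding I by (rule genideal_minimal[OF idM G])
  have GI: "?G \<subseteq> I" unfolding I by (rule genideal_self[OF Gcarr])
  show ?thesis
  proof (induction t)
    case 0
    have "I [^]\<^bsub>ideals_set R\<^esub> (0::nat) = carrier R"
      by (simp add: nat_pow_def ideals_set_def)
    then show ?case by (simp add: R monomial_ideal_def)
  next
    case (Suc t)
    have "I [^]\<^bsub>ideals_set R\<^esub> Suc t = ideal_prod R (?M t) I"
      using Suc by (simp add: nat_pow_def ideals_set_def)
    also have "\<dots> = ?M (Suc t)"
    proof
      show "ideal_prod R (?M t) I \<subseteq> ?M (Suc t)"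
      proof
        fix p assume "p \<in> ideal_prod R (?M t) I"
        then show "p \<in> ?M (Suc t)"
        proof induction
          case (prod i j)
          have j: "j \<in> ?M 1" using prod IM by blast
          show ?case unfolding R mpoly_ring_simps mem_monomial_ideal
          proof
            fix m assume "m \<in> Poly_Mapping.keys (i * j)"
            then obtain a b where ab: "m = a + b" "a \<in> Poly_Mapping.keys i"
              "b \<in> Poly_Mapping.keys j"
              by (rule keys_mult_cases)
            then show "Poly_Mapping.keys m \<subseteq> V \<and> packs (Suc t) (mset_of_pm m)"
              using prod(1) j packs_add[of t "mset_of_pm a" 1 "mset_of_pm b"]
              by (simp add: mem_monomial_ideal keys_add_nat)
          qed
        next
          case (sum s1 s2)
          then show ?case by (simp add: R monomial_ideal_add)
        qed
      qed
      show "?M (Suc t) \<subseteq> ideal_prod R (?M t) I"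
      proof
        fix p :: "('v \<Rightarrow>\<^sub>0 nat) \<Rightarrow>\<^sub>0 'k" assume p:
          "p \<in> ?M (Suc t)"
        show "p \<in> ideal_prod R (?M t) I"
        proof (rule mem_additive_of_terms)
          have "0 \<in> ?M t" "0 \<in> I"
            using additive_subgroup.zero_closed[OF ideal.axioms(1)[OF idI]]
              by (simp_all add: mem_monomial_ideal R)
          from ideal_prod.prod[OF this, of R] show "0 \<in> ideal_prod R (?M t) I" by (simp add: R)
          show "p + q \<in> ideal_prod R (?M t) I"
            if "p \<in> ideal_prod R (?M t) I" "q \<in> ideal_prod R (?M t) I" for p q
            using ideal_prod.sum[OF that] by (simp add: R)
          fix m assume m: "m \<in> Poly_Mapping.keys p"
          then have mV: "Poly_Mapping.keys m \<subseteq> V" "packs (Suc t) (mset_of_pm m)"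
            using p by (auto simp: mem_monomial_ideal)
          obtain u v k where uvk: "adj u v" "packs t (mset_of_pm k)"
            "m = Poly_Mapping.single u 1 + Poly_Mapping.single v 1 + k"
            using packs_mset_of_pm_Suc[OF mV(2)] .
          let ?c = "Poly_Mapping.lookup p m"
          have "Poly_Mapping.single k ?c \<in> ?M t"
            using uvk mV(1) by (auto simp: mem_monomial_ideal keys_add_nat)
          moreover have "mpoly_var u * mpoly_var v \<in> I" using GI uvk(1) by blast
          ultimately have "Poly_Mapping.single k ?c \<otimes>\<^bsub>R\<^esub> (mpoly_var u *
            mpoly_var v) \<in> ideal_prod R (?M t) I"
            by (rule ideal_prod.prod)
          then show "Poly_Mapping.single m ?c \<in> ideal_prod R (?M t) I"
            unfolding var by (simp add: R mult_single uvk(3) ac_simps)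
        qed
      qed
    qed
    finally show ?case .
  qed
qed

end

lemma Ass_power_edge_ideal:
  fixes R :: "(('v::linorder \<Rightarrow>\<^sub>0 nat) \<Rightarrow>\<^sub>0 'k::field) ring"
  assumes adj: "finite_adjacency adj V"
    and R: "R = mpoly_ring V" and I: "I
      = Idl\<^bsub>R\<^esub> {mpoly_var i * mpoly_var j | i j. adj i j}"
  shows "Ass_power R I t = face_prime V ` {F. F \<subseteq> V
    \<and> (\<exists>a. finite_adjacency.colon_witness adj V t F a)}"
proof -
  interpret finite_adjacency adj V by (rule adj)
  let ?Q = "\<lambda>m. packs t (mset_of_pm m)"
  have mono: "?Q (m + k)" if "?Q m" for m k using that by (auto intro: packs_mono)
  have "(\<exists>a. colon_witness t F a) \<longleftrightarrow> (\<exists>m. Poly_Mapping.keys m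
    \<subseteq> V \<and>
      (\<forall>k. Poly_Mapping.keys k \<subseteq> V \<longrightarrow> (?Q (m + k)
        \<longleftrightarrow> Poly_Mapping.keys k \<inter> F \<noteq> {})))" for F
  proof
    assume "\<exists>a. colon_witness t F a"
    then obtain a where a: "set_mset a \<subseteq> V"
      "\<And>k. set_mset k \<subseteq> V \<Longrightarrow> packs t (a + k)
        \<longleftrightarrow> set_mset k \<inter> F \<noteq> {}"
      by (auto simp: colon_witness_def)
    then have "?Q (pm_of_mset a + k)
      \<longleftrightarrow> Poly_Mapping.keys k \<inter> F \<noteq> {}" if "Poly_Mapping.keys k
        \<subseteq> V" for k
      using a(2)[of "mset_of_pm k"] that by simp
    then show "\<exists>m. Poly_Mapping.keys m \<subseteq> V \<and>
      (\<forall>k. Poly_Mapping.keys k \<subseteq> V \<longrightarrow> (?Q (m + k)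
        \<longleftrightarrow> Poly_Mapping.keys k \<inter> F \<noteq> {}))"
      using a(1) by (intro exI[of _ "pm_of_mset a"]) simp
  next
    assume "\<exists>m. Poly_Mapping.keys m \<subseteq> V \<and>
      (\<forall>k. Poly_Mapping.keys k \<subseteq> V \<longrightarrow> (?Q (m + k)
        \<longleftrightarrow> Poly_Mapping.keys k \<inter> F \<noteq> {}))"
    then obtain m where m: "Poly_Mapping.keys m \<subseteq> V"
      "\<And>k. Poly_Mapping.keys k \<subseteq> V \<Longrightarrow> ?Q (m + k)
        \<longleftrightarrow> Poly_Mapping.keys k \<inter> F \<noteq> {}"
      by blast
    then have "packs t (mset_of_pm m + k) \<longleftrightarrow> set_mset k \<inter> F \<noteq> {}"
      if "set_mset k \<subseteq> V" for k
      using m(2)[of "pm_of_mset k"] that by simp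
    then show "\<exists>a. colon_witness t F a"
      using m(1) by (intro exI[of _ "mset_of_pm m"]) (simp add: colon_witness_def)
  qed
  moreover have "Ass_power R I t = {P. primeideal P R \<and> (\<exists>r \<in> carrier R. P = {q
    \<in> carrier R. q \<otimes>\<^bsub>R\<^esub> r \<in> monomial_ideal V ?Q})}"
    unfolding Ass_power_def
    using edge_ideal_power[OF R _ I, of t] associated_primes_quot_module[of R "monomial_ideal V ?Q"]
      ideal_monomial_ideal[of ?Q V] mono cring_mpoly_ring[of V] adj_in_V adj_in_V' by (simp add: R)
  ultimately show ?thesis
    using colon_primes_monomial_ideal[of ?Q V, OF mono] by (simp add: R)
qed

section \<open>Ear decompositions and the stability index\<close>

lemma arcs_ends_induce_subgraph:
  "(u, v) \<in> arcs_ends (G \<restriction> U) \<longleftrightarrow> (u, v) \<in> arcs_ends G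
    \<and> u \<in> U \<and> v \<in> U"
  by (auto simp: arcs_ends_conv)

lemma set_vwalk_arcs_subset: "set (vwalk_arcs p) \<subseteq> E
  \<longleftrightarrow> successively (\<lambda>u v. (u, v) \<in> E) p"
  by (induction p rule: vwalk_arcs.induct) auto

definition ear_weight :: "'v list list \<Rightarrow> nat" where
  "ear_weight ws = (\<Sum>w\<leftarrow>ws. (length w - 1) div 2)"

context adjacency begin

text \<open>Passes between the inductive form, suited to growth, and the indexed form of
  \<open>gen_ear_decomp\<close> with an odd first walk.\<close>

lemma ear_decomp_iff:
  "ear_decomp S k ws \<longleftrightarrow> ws \<noteq> [] \<and> (\<forall>w \<in> set ws. ear w)
    \<and> hd (ws ! 0) = last (ws ! 0) \<and>
     odd (length (ws ! 0) - 1) \<and>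
     (\<forall>k. 0 < k \<and> k < length ws \<longrightarrow>
        set (ws ! k) \<inter> (\<Union>j<k. set (ws ! j)) = {hd (ws ! k), last (ws ! k)}) \<and>
     (\<Union>w \<in> set ws. set w) = S \<and> k = ear_weight ws" (is "_ \<longleftrightarrow> ?R S
       k ws")
proof
  assume "ear_decomp S k ws"
  then show "?R S k ws"
  proof induction
    case (start w)
    then show ?case by (auto simp: ear_weight_def)
  next
    case (step S k ws w)
    have "set ((ws @ [w]) ! i) \<inter> (\<Union>j<i. set ((ws @ [w]) ! j))
      = {hd ((ws @ [w]) ! i), last ((ws @ [w]) ! i)}"
      if i: "0 < i" "i < length (ws @ [w])" for i
    proof (cases "i < length ws")
      case True
      then have "(\<Union>j<i. set ((ws @ [w]) ! j)) = (\<Union>j<i. set (ws ! j))"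
        by (auto simp: nth_append)
      then show ?thesis using step True i by (simp add: nth_append)
    next
      case False
      then have "i = length ws" using i by simp
      moreover have "(\<Union>j<length ws. set ((ws @ [w]) ! j)) = (\<Union>w \<in> set ws. set w)"
        by (auto simp: nth_append set_conv_nth)
      ultimately show ?thesis using step by simp
    qed
    then show ?case using step by (auto simp: ear_weight_def nth_append)
  qed
next
  show "?R S k ws \<Longrightarrow> ear_decomp S k ws"
  proof (induction ws arbitrary: S k rule: rev_induct)
    case (snoc w ws)
    show ?case
    proof (cases "ws = []")
      case True
      then show ?thesis using snoc.prems start[of w] by (auto simp: ear_weight_def)
    next
      case False
      let ?S = "\<Union>w \<in> set ws. set w"
      have "set (ws ! i) \<inter> (\<Union>j<i. set (ws ! j)) = {hd (ws ! i), last (ws ! i)}"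
        if i: "0 < i" "i < length ws" for i
      proof -
        have "(\<Union>j<i. set ((ws @ [w]) ! j)) = (\<Union>j<i. set (ws ! j))"
          using i by (auto simp: nth_append)
        moreover have "set ((ws @ [w]) ! i) \<inter> (\<Union>j<i. set ((ws @ [w]) ! j)) =
            {hd ((ws @ [w]) ! i), last ((ws @ [w]) ! i)}"
          using snoc.prems i by simp
        ultimately show ?thesis using i by (simp add: nth_append)
      qed
      then have 1: "ear_decomp ?S (ear_weight ws) ws"
        using snoc.prems False by (intro snoc.IH) (auto simp: nth_append)
      have "(\<Union>j<length ws. set ((ws @ [w]) ! j)) = ?S"
        by (auto simp: nth_append set_conv_nth)
      moreover have "set ((ws @ [w]) ! length ws) \<inter> (\<Union>j<length ws. set ((ws @ [w]) !
        j)) =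
            {hd ((ws @ [w]) ! length ws), last ((ws @ [w]) ! length ws)}"
        using snoc.prems[THEN conjunct2, THEN conjunct2, THEN conjunct2, THEN conjunct2, THEN
          conjunct1,
            rule_format, of "length ws"] False by simp
      ultimately have "set w \<inter> ?S = {hd w, last w}" by simp
      from step[OF 1 _ this] show ?thesis
        using snoc.prems by (auto simp: ear_weight_def Un_commute)
    qed
  qed simp
qed

text \<open>The first walk, of odd length l, has l vertices. A later ear of length l adds l - 1,
  which makes 2 floor(l/2) when 1 is added for even l. Summed over components, this is the origin of
  (phi + m - c)/2.\<close>

lemma ear_decomp_card:
  assumes "ear_decomp S k ws"
  shows "finite S \<and> card S + length (filter (\<lambda>w. even (length w - 1)) ws) = 2 * k + 1"
  using assms
proof induction
  case (start w)
  then obtain x m where w: "w = x # m @ [x]"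
    using list_ends[of w] by (auto simp: ear_def)
  have "distinct (x # m)" using start(1) by (simp add: ear_def w butlast_append)
  moreover have "set w = set (x # m)" by (auto simp: w)
  ultimately have "card (set w) = length (x # m)" by (metis distinct_card)
  then show ?case using start(3) by (auto simp: w)
next
  case (step S k ws w)
  obtain x m s where w: "w = x # m @ [s]"
    using step(2) list_ends[of w] by (auto simp: ear_def)
  have m: "distinct m" "x \<notin> set m" "s \<notin> set m" using step(2)
    by (auto simp: ear_def w butlast_append)
  have xs: "x \<in> S" "s \<in> S" "set m \<inter> S = {}" using step(3) m by (auto simp: w)
  have "S \<union> set w = S \<union> set m" using xs by (auto simp: w)
  then have "card (S \<union> set w) = card S + length m"
    using step.IH xs m by (simp add: card_Un_disjoint distinct_card Int_commute)
  then show ?case using step.IH by (auto simp: w)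
qed

text \<open>A vertex y outside S next to x in S is reached by the closed walk x, y, x, so one odd
  cycle already extends to its whole component.\<close>

lemma ear_decomp_extend:
  assumes "ear_decomp S k ws" "S \<subseteq> C" "finite C"
    and conn: "\<And>T. T \<subset> C \<Longrightarrow> T \<noteq> {}
      \<Longrightarrow> \<exists>x\<in>T. \<exists>y\<in>C - T. adj x y"
  shows "\<exists>k ws. ear_decomp C k ws"
  using assms(1,2)
proof (induction "card (C - S)" arbitrary: S k ws rule: less_induct)
  case less
  show ?case
  proof (cases "S = C")
    case False
    have "S \<noteq> {}" using ear_decomp_card[OF less.prems(1)]
      ear_decomp_factor_critical[OF less.prems(1)] by blast
    then obtain x y where xy: "x \<in> S" "y \<in> C - S" "adj x y"
      using conn[of S] less.prems False by blast
    then have "x \<noteq> y" by blast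
    have "ear_decomp (S \<union> set [x, y, x]) (k + (length [x, y, x] - 1) div 2)
      (ws @ [[x, y, x]])"
      by (rule step[OF less.prems(1)])
        (use xy \<open>x \<noteq> y\<close> adj_sym in \<open>auto simp: ear_def\<close>)
    moreover have "card (C - (S \<union> set [x, y, x])) < card (C - S)"
      using xy assms(3) by (intro psubset_card_mono) auto
    moreover have "S \<union> set [x, y, x] \<subseteq> C" using xy less.prems by auto
    ultimately show ?thesis using less.hyps by blast
  qed (use less.prems in blast)
qed

end

section \<open>From the digraph library to the adjacency relation\<close>

context graph begin

abbreviation "adj \<equiv> \<lambda>u v. u \<rightarrow>\<^bsub>G\<^esub> v"

lemma adj_commute: "adj u v \<Longrightarrow> adj v u"
  using sym_arcs by (auto simp: symmetric_def dest: symD)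

lemma finite_adjacency_graph: "finite_adjacency adj (verts G)"
proof
  show "adj u v \<Longrightarrow> adj v u" for u v by (rule adj_commute)
  show "\<not> adj v v" for v using adj_not_same by blast
  show "adj u v \<Longrightarrow> u \<in> verts G" for u v by (rule adj_in_verts)
qed simp

interpretation A: finite_adjacency adj "verts G"
  by (rule finite_adjacency_graph)

text \<open>Reachability is symmetric here, so strong components are closed under adjacency; no cut
  is empty because a walk from T to a vertex outside T must cross it.\<close>

lemma sccs_induce:
  assumes U: "U \<subseteq> verts G"
  shows "A.components U (verts ` pre_digraph.sccs (G \<restriction> U))"
    and "inj_on verts (pre_digraph.sccs (G \<restriction> U))"
    and "\<And>C. C \<in> pre_digraph.sccs (G \<restriction> U) \<Longrightarrow> verts C
      \<subseteq> U \<and>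
      (\<forall>u v. u \<rightarrow>\<^bsub>C\<^esub> v \<longleftrightarrow> adj u v \<and> u \<in>
        verts C \<and> v \<in> verts C)"
proof -
  let ?H = "G \<restriction> U"
  interpret H: wf_digraph ?H by blast
  show "inj_on verts (pre_digraph.sccs ?H)" by (rule H.inj_on_verts_sccs)
  have sub: "S \<subseteq> U" if "S \<in> pre_digraph.sccs_verts ?H" for S
    using H.sccs_verts_subsets[OF that] by simp
  show "verts C \<subseteq> U \<and> (\<forall>u v. u \<rightarrow>\<^bsub>C\<^esub> v
    \<longleftrightarrow> adj u v \<and> u \<in> verts C \<and> v \<in> verts C)"
    if C: "C \<in> pre_digraph.sccs ?H" for C
  proof -
    obtain S where "C = ?H \<restriction> S" "S \<in> pre_digraph.sccs_verts ?H"
      using C[unfolded H.sccs_conv_sccs_verts] by (rule imageE)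
    then show ?thesis using sub[of S] by (auto simp: arcs_ends_induce_subgraph)
  qed
  have finU: "finite U" using U finite_verts finite_subset by blast
  have reach_sym: "v \<rightarrow>\<^sup>*\<^bsub>?H\<^esub> u"
    if "u \<rightarrow>\<^sup>*\<^bsub>?H\<^esub> v" for u v
  proof (rule symmetric_reachable[OF _ that])
    show "symmetric ?H"
      using adj_commute by (auto simp: symmetric_def sym_def arcs_ends_induce_subgraph)
  qed
  have reach_adj: "u \<rightarrow>\<^sup>*\<^bsub>?H\<^esub> v" if "adj u v" "u \<in> U" "v \<in> U"
    for u v
    using that by (intro H.reachable_adjI) (simp add: arcs_ends_induce_subgraph)
  have closed: "v \<in> S" if S: "S \<in> pre_digraph.sccs_verts ?H"
    and "u \<in> S" "u \<rightarrow>\<^sup>*\<^bsub>?H\<^esub> v" for S u v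
    using that reach_sym[of u v] unfolding H.in_sccs_verts_conv_reachable by blast
  show "A.components U (verts ` pre_digraph.sccs ?H)"
    unfolding A.components_def H.sccs_verts_conv[symmetric]
  proof (intro conjI ballI allI impI)
    show "finite (pre_digraph.sccs_verts ?H)"
      using sub finU by (meson finite_Pow_iff finite_subset PowI subsetI)
    show "\<Union> (pre_digraph.sccs_verts ?H) = U"
    proof
      show "\<Union> (pre_digraph.sccs_verts ?H) \<subseteq> U" using sub by blast
      show "U \<subseteq> \<Union> (pre_digraph.sccs_verts ?H)"
        using H.scc_of_in_sccs_verts H.in_scc_of_self by fastforce
    qed
    show "{} \<notin> pre_digraph.sccs_verts ?H" by (simp add: H.in_sccs_verts_conv_reachable)
    show "disjoint (pre_digraph.sccs_verts ?H)"
      using H.sccs_verts_disjoint by (auto simp: disjoint_def)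
    show "v \<in> S" if "S \<in> pre_digraph.sccs_verts ?H" "u \<in> S" "v \<in> U" "adj u v"
      for S u v
      using closed[OF that(1,2)] reach_adj that sub by blast
    fix S T
    assume S: "S \<in> pre_digraph.sccs_verts ?H" and T: "T \<subset> S" "T \<noteq> {}"
    then obtain x y where xy: "x \<in> T" "y \<in> S - T" by blast
    then have "x \<rightarrow>\<^sup>*\<^bsub>?H\<^esub> y" using S T
      unfolding H.in_sccs_verts_conv_reachable by blast
    then have "y \<in> T \<or> (\<exists>x\<in>T. \<exists>y\<in>S - T. adj x y)"
    proof (induction rule: H.reachable_induct)
      case base then show ?case using xy by blast
    next
      case (step a b)
      have "b \<in> S" if "a \<in> T"
        using closed[OF S, of a b] that T step by (meson H.reachable_adjI psubsetE subsetD)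
      then show ?case using step by (auto simp: arcs_ends_induce_subgraph)
    qed
    then show "\<exists>x\<in>T. \<exists>y\<in>S - T. adj x y" using xy by blast
  qed
qed

lemma ear_walk_component:
  assumes "U \<subseteq> verts G" "C \<in> pre_digraph.sccs (G \<restriction> U)"
  shows "ear_walk C w \<longleftrightarrow> A.ear w \<and> set w \<subseteq> verts C"
proof -
  have *: "u \<rightarrow>\<^bsub>C\<^esub> v \<longleftrightarrow> adj u v \<and> u \<in> verts C
    \<and> v \<in> verts C" for u v
    using sccs_induce(3)[OF assms] by blast
  have "successively (\<lambda>u v. u \<rightarrow>\<^bsub>C\<^esub> v) w
    \<longleftrightarrow> successively adj w" if "set w \<subseteq> verts C"
    using that unfolding * by (intro successively_cong) auto
  then show ?thesis
    unfolding ear_walk_def vwalk_def set_vwalk_arcs_subset A.ear_def by auto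
qed

lemma gen_ear_decomp_component:
  assumes "U \<subseteq> verts G" "C \<in> pre_digraph.sccs (G \<restriction> U)"
  shows "gen_ear_decomp C ws \<and> odd_cycle C (ws ! 0)
    \<longleftrightarrow> A.ear_decomp (verts C) (ear_weight ws) ws"
  unfolding gen_ear_decomp_def odd_cycle_def A.ear_decomp_iff ear_walk_component[OF assms]
    vwalk_length_simp
  by (cases "ws = []") auto

text \<open>Valid for every decomposition, so minimising the number of even walks is the same as
  minimising the total weight.\<close>

lemma even_walks_card:
  assumes U: "U \<subseteq> verts G" and D: "odd_beginning_ear_decomp (G \<restriction> U) D"
  shows "even_walks (G \<restriction> U) D + card U =
    2 * (\<Sum>C\<in>pre_digraph.sccs (G \<restriction> U). ear_weight (D C)) + card
      (pre_digraph.sccs (G \<restriction> U))"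
proof -
  let ?S = "pre_digraph.sccs (G \<restriction> U)"
  note comp = A.componentsD[OF sccs_induce(1)[OF U]]
  note inj = sccs_induce(2)[OF U]
  have ed: "A.ear_decomp (verts C) (ear_weight (D C)) (D C)" if "C \<in> ?S" for C
    using D that gen_ear_decomp_component[OF U that, of "D C"]
      unfolding odd_beginning_ear_decomp_def by blast
  have eq: "finite (verts C)
    \<and> card (verts C) + length (filter (\<lambda>w. even (length w - 1)) (D C)) = 2 * ear_weight
      (D C) + 1"
    if "C \<in> ?S" for C
    using A.ear_decomp_card[OF ed[OF that]] .
  have "card U = card (\<Union> (verts ` ?S))" using comp(2) by simp
  also have "\<dots> = (\<Sum>T\<in>verts ` ?S. card T)"
    using comp(4) eq by (intro card_Union_disjoint) auto
  also have "\<dots> = (\<Sum>C\<in>?S. card (verts C))"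
    using inj by (simp add: sum.reindex)
  finally have "even_walks (G \<restriction> U) D + card U =
      (\<Sum>C\<in>?S. card (verts C) + length (filter (\<lambda>w. even (length w - 1)) (D C)))"
    by (simp add: even_walks_def sum.distrib)
  also have "\<dots> = (\<Sum>C\<in>?S. 2 * ear_weight (D C) + 1)"
    using eq by (intro sum.cong) auto
  also have "\<dots> = 2 * (\<Sum>C\<in>?S. ear_weight (D C)) + card ?S"
    by (simp only: sum.distrib sum_distrib_left) simp
  finally show ?thesis .
qed

lemma mu_star_le:
  assumes U: "U \<subseteq> verts G" and D: "odd_beginning_ear_decomp (G \<restriction> U) D"
  shows "mu_star (G \<restriction> U) \<le> real (\<Sum>C\<in>pre_digraph.sccs (G \<restriction> U).
    ear_weight (D C))"
proof -
  have "phi_star (G \<restriction> U) \<le> even_walks (G \<restriction> U) D"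
    unfolding phi_star_def using D by (intro Least_le) blast
  then show ?thesis
    using arg_cong[OF even_walks_card[OF U D], of real] by (simp add: mu_star_def)
qed

lemma odd_beginning_ear_decomp_exists:
  assumes U: "U \<subseteq> verts G" and S: "strongly_nonbipartite (G \<restriction> U)"
  shows "\<exists>D. odd_beginning_ear_decomp (G \<restriction> U) D"
proof -
  have "\<exists>ws. gen_ear_decomp C ws \<and> odd_cycle C (ws ! 0)"
    if C: "C \<in> pre_digraph.sccs (G \<restriction> U)" for C
  proof -
    obtain w where "odd_cycle C w" using S C unfolding strongly_nonbipartite_def by blast
    then have w: "A.ear w" "set w \<subseteq> verts C" "hd w = last w" "odd (length w - 1)"
      unfolding odd_cycle_def ear_walk_component[OF U C] by simp_all
    have "finite (verts C)"
      using sccs_induce(3)[OF U C] U by (meson finite_subset finite_verts)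
    then obtain k ws where "A.ear_decomp (verts C) k ws"
      using A.ear_decomp_extend[OF A.start[OF w(1,3,4)] w(2)]
        A.componentsD(6)[OF sccs_induce(1)[OF U], of "verts C"] C
      by blast
    moreover from this have "k = ear_weight ws" by (simp add: A.ear_decomp_iff)
    ultimately show ?thesis using gen_ear_decomp_component[OF U C] by blast
  qed
  then show ?thesis unfolding odd_beginning_ear_decomp_def by metis
qed

text \<open>The \<open>LEAST\<close> in \<open>phi_star\<close> is attained because an odd-beginning
  decomposition exists.\<close>

lemma mu_star_attained:
  assumes U: "U \<subseteq> verts G" and S: "strongly_nonbipartite (G \<restriction> U)"
  shows "\<exists>D. odd_beginning_ear_decomp (G \<restriction> U) D \<and>
    mu_star (G \<restriction> U) = real (\<Sum>C\<in>pre_digraph.sccs (G \<restriction> U).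
      ear_weight (D C))"
proof -
  obtain D0 where D0: "odd_beginning_ear_decomp (G \<restriction> U) D0"
    using odd_beginning_ear_decomp_exists[OF U S] by blast
  have "\<exists>D. odd_beginning_ear_decomp (G \<restriction> U) D
    \<and> even_walks (G \<restriction> U) D = phi_star (G \<restriction> U)"
    unfolding phi_star_def by (rule LeastI_ex) (use D0 in blast)
  then obtain D where D: "odd_beginning_ear_decomp (G \<restriction> U) D"
    "even_walks (G \<restriction> U) D = phi_star (G \<restriction> U)"
    by blast
  then show ?thesis
    using arg_cong[OF even_walks_card[OF U D(1)], of real]
    by (intro exI[of _ D]) (simp add: mu_star_def)
qed

section \<open>The invariant s and colon ideals\<close>

lemma cover_core_eq: "cover_core G F = A.core F"
  by (simp add: cover_core_def A.core_def)

lemma vertex_cover_iff: "vertex_cover G F \<longleftrightarrow> A.cover F"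
  by (simp add: vertex_cover_def A.cover_def)

lemma minimal_cover_iff: "minimal_cover G F \<longleftrightarrow> A.cover F \<and> A.core F = {}"
  using A.core_empty_iff unfolding minimal_cover_def vertex_cover_iff by blast

text \<open>By domination every component C of c meets a component of U, which then lies inside C
  and brings its odd cycle along. So a suitable U already makes the cover admissible.\<close>

lemma strongly_nonbipartite_dominated:
  assumes c: "c \<subseteq> verts G" and U: "dominating_set (G \<restriction> c) U"
    "strongly_nonbipartite (G \<restriction> U)"
  shows "strongly_nonbipartite (G \<restriction> c)"
  unfolding strongly_nonbipartite_def
proof
  have Uc: "U \<subseteq> c" and dom: "\<And>v. v \<in> c \<Longrightarrow> v
    \<in> U \<or> (\<exists>u \<in> U. adj v u)"
    using U(1) by (auto simp: dominating_set_def arcs_ends_induce_subgraph)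
  have UG: "U \<subseteq> verts G" using Uc c by blast
  note compU = A.componentsD[OF sccs_induce(1)[OF UG]]
    and compc = A.componentsD[OF sccs_induce(1)[OF c]]
  fix C assume C: "C \<in> pre_digraph.sccs (G \<restriction> c)"
  then have VC: "verts C \<in> verts ` pre_digraph.sccs (G \<restriction> c)" by blast
  then obtain v where v: "v \<in> verts C" using compc(3) by (metis ex_in_conv)
  have "v \<in> c" using compc(2) VC v by blast
  then obtain u where u: "u \<in> verts C" "u \<in> U" using dom v compc(5)[OF VC v] Uc by blast
  then obtain B where B: "B \<in> pre_digraph.sccs (G \<restriction> U)" "u \<in> verts B"
    using compU(2) by blast
  have "verts B \<subseteq> verts C"
  proof (rule ccontr)
    assume "\<not> verts B \<subseteq> verts C"
    then have proper: "verts B \<inter> verts C \<subset> verts B"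
      "verts B \<inter> verts C \<noteq> {}" using u B by blast+
    have VB: "verts B \<in> verts ` pre_digraph.sccs (G \<restriction> U)" using B by blast
    obtain x y where xy: "x \<in> verts B \<inter> verts C"
      "y \<in> verts B - verts B \<inter> verts C" "adj x y"
      using compU(6)[OF VB proper] by blast
    have "y \<in> U" using VB compU(2) xy(2) by blast
    then have "y \<in> verts C" using compc(5)[OF VC _ _ xy(3)] xy(1) Uc by blast
    then show False using xy(2) by blast
  qed
  moreover obtain w where "odd_cycle B w" using U(2) B unfolding strongly_nonbipartite_def by blast
  ultimately have "odd_cycle C w"
    unfolding odd_cycle_def ear_walk_component[OF UG B(1)] ear_walk_component[OF c C] by blast
  then show "\<exists>w. odd_cycle C w" ..
qed

lemma colon_witness_iff_dominating:
  assumes F: "A.cover F" "A.core F \<noteq> {}" and t: "1 \<le> t"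
  shows "(\<exists>a. A.colon_witness t F a) \<longleftrightarrow>
    (\<exists>U. dominating_set (G \<restriction> A.core F) U \<and> strongly_nonbipartite (G \<restriction> U) \<and>
      mu_star (G \<restriction> U) \<le> real (t - 1))"
proof
  have cV: "A.core F \<subseteq> verts G" using F(1) by (auto simp: A.core_def A.cover_def)
  have dom_iff: "dominating_set (G \<restriction> A.core F) U \<longleftrightarrow>
      U \<subseteq> A.core F \<and> (\<forall>i \<in> A.core F. i \<in> U \<or>
        (\<exists>u \<in> U. adj i u))" for U
    by (auto simp: dominating_set_def arcs_ends_induce_subgraph)
  {
    assume "\<exists>a. A.colon_witness t F a"
    then obtain a0 where "A.colon_witness t F a0" ..
    from A.core_critical[OF this F(1)]
    obtain a t' where a: "set_mset a \<subseteq> A.core F" "t' \<le> t" "\<not> A.packs t' a"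
      and crit: "\<forall>i \<in> A.core F. A.packs t' (add_mset i a)"
      by (elim exE conjE)
    obtain U where U: "U \<subseteq> A.core F"
      "\<forall>i \<in> A.core F. \<exists>u \<in> U. adj i u"
      "\<And>Cs. A.components U Cs \<Longrightarrow>
        \<exists>k ws. (\<forall>C \<in> Cs. A.ear_decomp C (k C) (ws C)) \<and>
          (\<Sum>C\<in>Cs. k C) < t'"
      using A.dominating_ear_decomp[OF a(3) bspec[OF crit] a(1)] by blast
    have UG: "U \<subseteq> verts G" using U(1) cV by blast
    let ?S = "pre_digraph.sccs (G \<restriction> U)"
    obtain k ws where ws: "\<And>C. C \<in> verts ` ?S
      \<Longrightarrow> A.ear_decomp C (k C) (ws C)" "(\<Sum>C\<in>verts ` ?S. k C) < t'"
      using U(3)[OF sccs_induce(1)[OF UG]] by blast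
    have k: "k (verts C) = ear_weight (ws (verts C))" if "C \<in> ?S" for C
      using ws(1)[of "verts C"] that by (simp add: A.ear_decomp_iff)
    define D where "D C = ws (verts C)" for C :: "('a, 'b) pre_digraph"
    have D: "gen_ear_decomp C (D C) \<and> odd_cycle C (D C ! 0)" if "C \<in> ?S" for C
      using gen_ear_decomp_component[OF UG that, of "D C"] ws(1)[of "verts C"] k[OF that] that
        by (simp add: D_def)
    then have odd: "odd_beginning_ear_decomp (G \<restriction> U) D"
      by (simp add: odd_beginning_ear_decomp_def)
    have "(\<Sum>C\<in>?S. ear_weight (D C)) = (\<Sum>C\<in>verts ` ?S. k C)"
      using sccs_induce(2)[OF UG] k by (simp add: sum.reindex D_def)
    then have "(\<Sum>C\<in>?S. ear_weight (D C)) \<le> t - 1" using ws(2) a(2) by linarith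
    then have "mu_star (G \<restriction> U) \<le> real (t - 1)"
      using mu_star_le[OF UG odd] by (meson of_nat_le_iff order.trans)
    moreover have "strongly_nonbipartite (G \<restriction> U)"
      using D unfolding strongly_nonbipartite_def by blast
    moreover have "dominating_set (G \<restriction> A.core F) U" using U(1,2) dom_iff by blast
    ultimately show "\<exists>U. dominating_set (G \<restriction> A.core F) U
      \<and> strongly_nonbipartite (G \<restriction> U) \<and>
        mu_star (G \<restriction> U) \<le> real (t - 1)" by blast
  }
  {
    assume "\<exists>U. dominating_set (G \<restriction> A.core F) U
      \<and> strongly_nonbipartite (G \<restriction> U) \<and>
        mu_star (G \<restriction> U) \<le> real (t - 1)"
    then obtain U where U: "U \<subseteq> A.core F"
      "\<And>i. i \<in> A.core F \<Longrightarrow> i \<in> U \<or> (\<exists>u \<in> U. adj i u)"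
      "strongly_nonbipartite (G \<restriction> U)" "mu_star (G \<restriction> U) \<le> real (t - 1)"
      unfolding dom_iff by blast
    have UG: "U \<subseteq> verts G" using U(1) cV by blast
    let ?S = "pre_digraph.sccs (G \<restriction> U)"
    obtain D where D: "odd_beginning_ear_decomp (G \<restriction> U) D"
      "mu_star (G \<restriction> U) = real (\<Sum>C\<in>?S. ear_weight (D C))"
      using mu_star_attained[OF UG U(3)] by blast
    \<comment> \<open>D is indexed by subgraphs, the combinatorial lemmas by vertex sets; the
      inverse of \<open>verts\<close> on the components translates.\<close>
    define ws k where "ws T = D (inv_into ?S verts T)"
      and "k T = ear_weight (D (inv_into ?S verts T))" for T
    note inj = sccs_induce(2)[OF UG]
    have inv: "inv_into ?S verts (verts C) = C" if "C \<in> ?S" for C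
      using inj that by (rule inv_into_f_f)
    have ears: "A.ear_decomp C (k C) (ws C)" if C: "C \<in> verts ` ?S" for C
    proof -
      obtain B where B: "B \<in> ?S" "C = verts B" using C by blast
      then show ?thesis
        using D(1) gen_ear_decomp_component[OF UG B(1), of "D B"] inv[OF B(1)]
        unfolding odd_beginning_ear_decomp_def k_def ws_def by simp
    qed
    have "(\<Sum>C\<in>verts ` ?S. k C) = (\<Sum>C\<in>?S. ear_weight (D C))"
      using inj inv by (simp add: sum.reindex k_def)
    then have less: "(\<Sum>C\<in>verts ` ?S. k C) < t" using U(4) D(2) t by linarith
    have "U \<noteq> {}" using F(2) U(2) by blast
    then obtain a where "set_mset a = U" "\<not> A.packs t a"
      "\<forall>i \<in> A.core F. A.packs t (add_mset i a)"
      using A.critical_of_ear_decomp[OF sccs_induce(1)[OF UG] _ ears less U(2)] by blast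
    then have "A.colon_witness t F (a + mset_set (verts G - F))"
      using U(1) by (intro A.colon_witness_core F) auto
    then show "\<exists>a. A.colon_witness t F a" ..
  }
qed

lemma admissible_cover_subset: "F \<in> admissible_covers G \<Longrightarrow> F \<subseteq> verts G"
  by (auto simp: admissible_covers_def minimal_cover_def vertex_cover_def)

text \<open>The core dominates itself, so the set is nonempty, and its members are indexed by
  subsets of the core.\<close>

lemma s_core_Min:
  assumes F: "F \<in> admissible_covers G" "\<not> minimal_cover G F"
  defines "M \<equiv> {mu_star (G \<restriction> U) | U. dominating_set (G \<restriction> A.core F)
    U \<and> strongly_nonbipartite (G \<restriction> U)}"
  shows "finite M" "M \<noteq> {}" "s_core G F = Min M"
proof -
  have "A.core F \<subseteq> F" "F \<subseteq> verts G" using admissible_cover_subset[OF F(1)]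
    by (auto simp: A.core_def)
  then have "finite (Pow (A.core F))" by (meson finite_Pow_iff finite_subset finite_verts)
  moreover have "M \<subseteq> (\<lambda>U. mu_star (G \<restriction> U)) ` Pow (A.core F)"
    by (auto simp: M_def dominating_set_def)
  ultimately show "finite M" by (meson finite_imageI finite_subset)
  have "strongly_nonbipartite (G \<restriction> A.core F)"
    using F by (auto simp: admissible_covers_def cover_core_eq)
  moreover have "dominating_set (G \<restriction> A.core F) (A.core F)"
    by (simp add: dominating_set_def)
  ultimately show "M \<noteq> {}" by (auto simp: M_def)
  show "s_core G F = Min M" using F(2) by (simp add: s_core_def M_def cover_core_eq)
qed

text \<open>An attained \<open>mu_star\<close> is a sum of natural weights, so halving leaves no
  fraction and s can only jump at integers.\<close>

lemma s_core_nat: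
  assumes "F \<in> admissible_covers G"
  shows "\<exists>m. s_core G F = real m"
proof (cases "minimal_cover G F")
  case True
  then show ?thesis by (simp add: s_core_def)
next
  case False
  note M = s_core_Min[OF assms False]
  obtain U where U: "s_core G F = mu_star (G \<restriction> U)"
    "dominating_set (G \<restriction> A.core F) U" "strongly_nonbipartite (G \<restriction> U)"
    using Min_in[OF M(1,2)] M(3) by auto
  have "U \<subseteq> verts G"
    using U(2) admissible_cover_subset[OF assms] by (auto simp: dominating_set_def A.core_def)
  then show ?thesis using mu_star_attained U by metis
qed

text \<open>The bound on s grows with t, so a cover that has entered stays. Minimal covers have s =
  0 and are present from t = 1.\<close>

lemma colon_witness_iff_admissible:
  assumes t: "1 \<le> t"
  shows "F \<subseteq> verts G \<and> (\<exists>a. A.colon_witness t F a) \<longleftrightarrow> F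
    \<in> admissible_covers G \<and> s_core G F \<le> real (t - 1)"
proof (cases "A.cover F")
  case False
  then show ?thesis
    using A.colon_witness_cover by (auto simp: admissible_covers_def minimal_cover_def
      vertex_cover_iff)
next
  case F: True
  then have FG: "F \<subseteq> verts G" by (simp add: A.cover_def)
  show ?thesis
  proof (cases "A.core F = {}")
    case True
    then have "minimal_cover G F" using F minimal_cover_iff by blast
    then show ?thesis using A.colon_witness_minimal[OF F True t] FG
      by (simp add: admissible_covers_def s_core_def)
  next
    case False
    then have nm: "\<not> minimal_cover G F" using minimal_cover_iff by blast
    let ?P = "\<lambda>U. dominating_set (G \<restriction> A.core F) U
      \<and> strongly_nonbipartite (G \<restriction> U)"
    have cV: "A.core F \<subseteq> verts G" using FG by (auto simp: A.core_def)
    have "F \<in> admissible_covers G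
      \<longleftrightarrow> strongly_nonbipartite (G \<restriction> A.core F)"
      using nm F by (simp add: admissible_covers_def vertex_cover_iff cover_core_eq)
    moreover have "(\<exists>U. ?P U \<and> mu_star (G \<restriction> U) \<le> real (t - 1))
      \<longleftrightarrow> s_core G F \<le> real (t - 1)"
      if "F \<in> admissible_covers G"
      using Min_le_iff[OF s_core_Min(1,2)[OF that nm], of "real (t - 1)"] s_core_Min(3)[OF that nm]
        by auto
    ultimately show ?thesis
      using colon_witness_iff_dominating[OF F False t] strongly_nonbipartite_dominated[OF cV] FG
        by blast
  qed
qed

end

lemma Ass_power_admissible_covers:
  fixes \<Gamma> :: "('v::linorder, 'e) pre_digraph"
    and R :: "(('v \<Rightarrow>\<^sub>0 nat) \<Rightarrow>\<^sub>0 'k::field) ring"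
  assumes "graph \<Gamma>" "R = mpoly_ring (verts \<Gamma>)" "1 \<le> t"
  shows "Ass_power R (edge_ideal \<Gamma>) t =
    face_prime (verts \<Gamma>) ` {F \<in> admissible_covers \<Gamma>. s_core \<Gamma> F \<le> real
      (t - 1)}"
  using Ass_power_edge_ideal[OF graph.finite_adjacency_graph[OF assms(1)] assms(2), of
    "edge_ideal \<Gamma>" t]
    graph.colon_witness_iff_admissible[OF assms(1,3)]
  by (simp add: edge_ideal_def assms(2))

theorem corollary4p9:
  fixes \<Gamma> :: "(nat, 'e) pre_digraph"
    and n :: nat
    and R :: "((nat \<Rightarrow>\<^sub>0 nat) \<Rightarrow>\<^sub>0 'k::field) ring"
    and I :: "((nat \<Rightarrow>\<^sub>0 nat) \<Rightarrow>\<^sub>0 'k) set"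
  assumes "graph \<Gamma>"
    and "verts \<Gamma> = {1..n}"
    and "R = mpoly_ring {1..n}"
    and "I = edge_ideal \<Gamma>"
  shows "real (astab R I) = Max {s_core \<Gamma> F | F. F \<in> admissible_covers \<Gamma>} + 1"
proof -
  interpret graph \<Gamma> by fact
  let ?A = "admissible_covers \<Gamma>"
  have "\<exists>s. \<forall>F\<in>?A. s_core \<Gamma> F = real (s F)"
    using s_core_nat by (intro bchoice) blast
  then obtain s where s: "\<And>F. F \<in> ?A \<Longrightarrow> s_core \<Gamma> F = real (s F)"
    by blast
  have "?A \<subseteq> Pow (verts \<Gamma>)" using admissible_cover_subset by blast
  then have finA: "finite ?A" by (meson finite_Pow_iff finite_subset finite_verts)
  \<comment> \<open>A cover of least cardinality is minimal, so the maximum ranges over a nonempty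
    set.\<close>
  have "vertex_cover \<Gamma> (verts \<Gamma>)" by (auto simp: vertex_cover_def adj_in_verts)
  then obtain F0 where "vertex_cover \<Gamma> F0"
    "\<And>F. vertex_cover \<Gamma> F \<Longrightarrow> card F0 \<le> card F"
    using ex_has_least_nat[of "vertex_cover \<Gamma>" _ card] by blast
  then have "minimal_cover \<Gamma> F0"
    unfolding minimal_cover_def by (meson finite_subset finite_verts leD psubset_card_mono
      vertex_cover_def)
  then have neA: "?A \<noteq> {}" by (auto simp: admissible_covers_def)
  define K where "K = Max (s ` ?A)"
  have s_le: "s F \<le> K" if "F \<in> ?A" for F
    unfolding K_def using finA that by (intro Max_ge) auto
  \<comment> \<open>F1 is a cover that enters last: it is present at K + 1 but not at K.\<close>
  have "K \<in> s ` ?A" unfolding K_def using finA neA by (intro Max_in) auto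
  then obtain F1 where F1: "F1 \<in> ?A" "s F1 = K" by blast
  have "{s_core \<Gamma> F | F. F \<in> ?A} = s_core \<Gamma> ` ?A" by blast
  also have "\<dots> = (\<lambda>F. real (s F)) ` ?A" using s by (intro image_cong) auto
  finally have "{s_core \<Gamma> F | F. F \<in> ?A} = (\<lambda>F. real (s F)) ` ?A" .
  then have Max: "Max {s_core \<Gamma> F | F. F \<in> ?A} = real K"
    using s_le F1 finA by (intro Max_eqI) auto
  define B where "B t = {F \<in> ?A. s_core \<Gamma> F \<le> real (t - 1)}" for t :: nat
  have Ass: "Ass_power R I t = face_prime (verts \<Gamma>) ` B t" if "1 \<le> t" for t
    unfolding B_def assms(4) using assms(1-3) that by (intro Ass_power_admissible_covers) auto
  have B_all: "B t = ?A" if "K + 1 \<le> t" for t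
    using s s_le that unfolding B_def by fastforce
  have "astab R I = K + 1"
    unfolding astab_def
  proof (rule Least_equality)
    show "1 \<le> K + 1 \<and> (\<forall>t\<ge>K + 1. Ass_power R I t = Ass_power R I (t + 1))"
      by (auto simp: Ass B_all)
    fix t0 assume t0: "1 \<le> t0 \<and> (\<forall>t\<ge>t0. Ass_power R I t
      = Ass_power R I (t + 1))"
    show "K + 1 \<le> t0"
    proof (rule ccontr)
      assume "\<not> K + 1 \<le> t0"
      then have K: "t0 \<le> K" "1 \<le> K" using t0 by auto
      then have eq: "face_prime (verts \<Gamma>) ` B K
        = (face_prime (verts \<Gamma>) ` B (K + 1) :: ((nat \<Rightarrow>\<^sub>0 nat)
          \<Rightarrow>\<^sub>0 'k) set set)"
        using t0 Ass[OF K(2)] Ass[OF le_add2, of K] by metis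
      have "B K \<subseteq> Pow (verts \<Gamma>)" "B (K + 1) \<subseteq> Pow (verts \<Gamma>)"
        using admissible_cover_subset by (auto simp: B_def)
      from inj_on_image_eq_iff[OF inj_on_face_prime this, THEN iffD1, OF eq]
      have "B K = B (K + 1)" .
      then have "F1 \<in> B K" using B_all[of "K + 1"] F1 by simp
      \<comment> \<open>At t = K the bound on s is K - 1, which is less than K since K is
        positive.\<close>
      then show False using s[OF F1(1)] F1(2) K by (simp add: B_def)
    qed
  qed
  then show ?thesis using Max by simp
qed

end
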